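(* Consider the $N$-player game $\mathcal{G}(V,\Omega_i,J_i)$, $V=\{1,\dots,N\}$, and the communication graph $G_c=(V,E)$. Assume: (1) for every $i\in V$, $\Omega_i\subset\mathbb{R}$ is non-empty, compact and convex, and $J_i:\mathbb{R}^N\to\mathbb{R}$, $(x_i,x_{-i})\mapsto J_i(x_i,x_{-i})$, is $C^1$ and convex in $x_i$ for every $x_{-i}$, and jointly continuous in $x$; (2) there are $\mu>0$, $\theta_0>0$ such that $\langle x-y,F(x)-F(y)\rangle\ge\mu\|x-y\|^2$ and $\|F(x)-F(y)\|\le\theta_0\|x-y\|$ for all $x,y\in\mathbb{R}^N$, where $F$ is the pseudo-gradient; (3) $G_c$ is undirected and connected (with no isolated vertex); (4) there is $\theta>0$ such that $\|\mathbf{F}(\mathbf{x})-\mathbf{F}(\mathbf{y})\|\le\theta\|\mathbf{x}-\mathbf{y}\|$ for all $\mathbf{x},\mathbf{y}\in\mathbb{R}^{N^2}$, where $\mathbf{F}$ is the extended pseudo-gradient. Take an arbitrary $c>0$ and any $c_0>c_{\min}$, where $c_{\min}\lambda_2(L)=\frac{(\theta+\theta_0)^2}{4\mu}+\theta$, and let $\bar c=c+c_0$. Let $$\Psi=\begin{bmatrix}\frac{\mu}{N} & -\frac{\theta+\theta_0}{2\sqrt N}\\ -\frac{\theta+\theta_0}{2\sqrt N} & c_0\lambda_2(L)-\theta\end{bmatrix},\qquad \bar\mu=\lambda_{\min}(\Psi),\qquad \bar\theta=\theta+2c_0d^*,$$ where $d^*$ is the maximal degree of $G_c$. Let $\beta_i>0$,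 $i\in V$, be such that, with $\mathbb{B}=\mathrm{diag}((\beta_i)_{i\in V})$ and $H=\mathbb{B}+2\bar c\,\mathbb{D}-c\,L$, one has $\lambda_{\min}(H)>\frac{\bar\theta^2}{2\bar\mu}$. Let $\mathbf{x}(k),\mathbf{w}(k)$ be generated by Algorithm 1 (defined in the context, with parameters $c,c_0,\beta_i$), and let $\mathbf{x}^\perp(k)$ be the component of $\mathbf{x}(k)$ in $\mathrm{Ker}(\mathbf{L})^\perp$. Then, as $k\to\infty$, $$\|\mathbf{x}^\perp(k)\|_{\mathbf{L}}^2=o\!\left(\tfrac1k\right),$$ and, for some $y=y(k)\in\mathbf{G}(\mathbf{x}(k))$ (for each $k\ge1$), $$\big\|\mathbf{R}\big(\mathbf{F}(\mathbf{x}(k-1))+y\big)+\mathbf{w}(k+1)+c_0\mathbf{L}\mathbf{x}^\perp(k-1)\big\|^2_{(H\otimes I_N)^{-1}}=o\!\left(\tfrac1k\right).$$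
   Context: Game: player $i\in V$ has action $x_i\in\Omega_i\subset\mathbb{R}$ and cost $J_i(x_i,x_{-i})$, $x=(x_i,x_{-i})\in\mathbb{R}^N$, where $x_{-i}$ collects the actions of all players other than $i$. Pseudo-gradient: $F(x)=[\nabla_iJ_i(x)]_{i\in V}\in\mathbb{R}^N$, $\nabla_iJ_i=\partial J_i/\partial x_i$. Extended pseudo-gradient: for $\mathbf{x}=[x^1;\dots;x^N]\in\mathbb{R}^{N^2}$ with $x^i=(x_i^i,x_{-i}^i)\in\mathbb{R}^N$, $\mathbf{F}(\mathbf{x})=[\nabla_iJ_i(x^i)]_{i\in V}\in\mathbb{R}^N$. Set-valued map: $\mathbf{G}(\mathbf{x})=[\partial\mathcal{I}_{\Omega_i}(x_i^i)]_{i\in V}=\prod_{i\in V}N_{\Omega_i}(x_i^i)\subset\mathbb{R}^N$, with $\mathcal{I}_{\Omega_i}$ the indicator function ($0$ on $\Omega_i$, $+\infty$ off it), $\partial$ the convex subdifferential and $N_{\Omega_i}$ the normal cone. Graph: $N_i$ is the set of neighbours of $i$ in $G_c$; $\mathbb{D}=\mathrm{diag}(|N_1|,\dots,|N_N|)$; $L=\mathbb{D}-A$ is the Laplacian ($A$ the adjacency matrix); $\lambda_2(L)>0$ is its smallest nonzero eigenvalue; $d^*=\max_i|N_i|$. $\mathbf{L}=L\otimes I_N$, whose kernel is the consensus subspace $\{\mathbf{1}_N\otimes x: x\in\mathbb{R}^N\}$; every $\mathbf{x}\in\mathbb{R}^{N^2}$ decomposes orthogonally as $\mathbf{x}=\mathbf{x}^{\|}+\mathbf{x}^\perp$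 with $\mathbf{x}^{\|}\in\mathrm{Ker}(\mathbf{L})$, $\mathbf{x}^\perp\in\mathrm{Ker}(\mathbf{L})^\perp$. $\mathbf{R}=\mathrm{diag}([e_i]_{i\in V})$ is the $N^2\times N$ block-diagonal matrix with the unit vectors $e_i\in\mathbb{R}^N$ as diagonal blocks. $\|v\|_M=\sqrt{v^TMv}$ for symmetric $M\succeq0$. $\lambda_{\min}$ denotes the minimum eigenvalue. $a(k)=o(1/k)$ means $\lim_{k\to\infty}k\,a(k)=0$. Algorithm 1: player $i$ keeps an estimate $x^i=(x_i^i,x_{-i}^i)\in\mathbb{R}^N$ of all actions and a dual vector $w^i=(w_i^i,w_{-i}^i)\in\mathbb{R}^N$; $\mathbf{x}=[x^1;\dots;x^N]$, $\mathbf{w}=[w^1;\dots;w^N]$. Parameters: $c>0$, $c_0>0$, $\bar c=c+c_0$, $\beta_i>0$, $\alpha_i=\beta_i+2\bar c|N_i|$. Initialization: $x_i^i(0)\in\Omega_i$, $x_{-i}^i(0)\in\mathbb{R}^{N-1}$ arbitrary, $w^i(0)=\mathbf{0}_N$. For $k=1,2,\dots$ and each $i\in V$: $$w^i(k)=w^i(k-1)+c\sum_{j\in N_i}\big(x^i(k-1)-x^j(k-1)\big),$$ $$x_i^i(k)=T_{\Omega_i}\Big\{\alpha_i^{-1}\Big[-\nabla_iJ_i(x^i(k-1))-w_i^i(k)+\beta_ix_i^i(k-1)+\bar c\sum_{j\in N_i}\big(x_i^i(k-1)+x_i^j(k-1)\big)\Big]\Big\},$$ $$x_{-i}^i(k)=\alpha_i^{-1}\Big[\beta_ix_{-i}^i(k-1)+\bar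 c\sum_{j\in N_i}\big(x_{-i}^i(k-1)+x_{-i}^j(k-1)\big)-w_{-i}^i(k)\Big],$$ where $T_{\Omega_i}$ is Euclidean projection onto $\Omega_i$, and $x^j_{-i}$ denotes $x^j$ with its $i$-th component removed. *)

theory Defs
  imports "HOL-Analysis.Analysis" "HOL-Library.Landau_Symbols"
begin

text \<open>
  Players are the elements of a finite type \<open>'n\<close>, so $N$ is \<open>CARD('n)\<close>. A stacked vector
  $[x^1;\dots;x^N]$ of $\mathbb{R}^{N^2}$ is an element of \<open>real^('n \<times> 'n)\<close> whose entry at
  \<open>(i, j)\<close> is the \<open>j\<close>-th component of the block $x^i$.
\<close>

definition diag_mat :: "('n::finite \<Rightarrow> real) \<Rightarrow> real^'n^'n" where
  "diag_mat d = (\<chi> i j. if i = j then d i else 0)"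

definition kron :: "real^'a^'b \<Rightarrow> real^'c^'d \<Rightarrow> real^('a::finite \<times> 'c::finite)^('b::finite \<times> 'd::finite)"
    (infixl "\<otimes>\<^sub>K" 75) where
  "A \<otimes>\<^sub>K B = (\<chi> p q. A $ fst p $ fst q * B $ snd p $ snd q)"

definition real_eigenvalues :: "real^'n^'n \<Rightarrow> real set" where
  "real_eigenvalues A = {l. \<exists>v. v \<noteq> 0 \<and> A *v v = l *\<^sub>R v}"

text \<open>
  \<open>lambda_min\<close>, \<open>lambda2\<close> and \<open>weighted_norm\<close> are only meant for symmetric matrices: all
  eigenvalues are then real, and there are finitely many of them (\<open>finite_real_eigenvalues\<close>), so
  that \<open>Min\<close> is well defined.
\<close>

definition lambda_min :: "real^'n^'n \<Rightarrow> real" where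
  "lambda_min A = Min (real_eigenvalues A)"

definition weighted_norm :: "real^'m^'m \<Rightarrow> real^'m \<Rightarrow> real" where
  "weighted_norm M v = sqrt (v \<bullet> (M *v v))"

definition kernel :: "real^'n^'m \<Rightarrow> (real^'n) set" where
  "kernel A = {v. A *v v = 0}"

text \<open>The component of \<open>x\<close> in the orthogonal complement of the subspace \<open>S\<close>.\<close>

definition perp_part :: "'a::euclidean_space set \<Rightarrow> 'a \<Rightarrow> 'a" where
  "perp_part S x = (THE z. z \<in> S\<^sup>\<bottom> \<and> x - z \<in> S)"

lemma subspace_kernel: "subspace (kernel A)"
  by (auto simp: subspace_def kernel_def matrix_vector_right_distrib matrix_vector_mult_scaleR)

lemma finite_real_eigenvalues:
  fixes A :: "real^'n^'n"
  assumes "transpose A = A"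
  shows "finite (real_eigenvalues A)"
proof -
  define f where "f l = (SOME v. v \<noteq> 0 \<and> A *v v = l *\<^sub>R v)" for l
  have f: "f l \<noteq> 0 \<and> A *v f l = l *\<^sub>R f l" if "l \<in> real_eigenvalues A" for l
    using that someI_ex[of "\<lambda>v. v \<noteq> 0 \<and> A *v v = l *\<^sub>R v"]
    by (simp add: f_def real_eigenvalues_def)
  have orth: "f l \<bullet> f m = 0"
    if "l \<in> real_eigenvalues A" "m \<in> real_eigenvalues A" "l \<noteq> m" for l m
  proof -
    have "(A *v f l) \<bullet> f m = f l \<bullet> (A *v f m)"
      using dot_lmul_matrix[of "f l" A "f m"] transpose_matrix_vector[of A "f l"] assms by simp
    with f[OF that(1)] f[OF that(2)] that(3) show ?thesis by simp
  qed
  have inj: "inj_on f (real_eigenvalues A)"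
    proof (rule inj_onI)
    fix l m assume lm: "l \<in> real_eigenvalues A" "m \<in> real_eigenvalues A" "f l = f m"
    then have "f l \<bullet> f m \<noteq> 0" using f[OF lm(2)] by simp
    with orth lm show "l = m" by blast
  qed
  have "pairwise orthogonal (f ` real_eigenvalues A)"
    using orth by (force simp: pairwise_def orthogonal_def)
  moreover have "0 \<notin> f ` real_eigenvalues A" using f by force
  ultimately have "independent (f ` real_eigenvalues A)"
    using pairwise_orthogonal_independent by blast
  then have "finite (f ` real_eigenvalues A)" by (rule independent_imp_finite)
  then show ?thesis using inj finite_imageD by blast
qed

lemma perp_part_unique:
  fixes S :: "'a::euclidean_space set"
  assumes "subspace S"
  shows "\<exists>!z. z \<in> S\<^sup>\<bottom> \<and> x - z \<in> S"
proof -
  obtain y z where yz: "y \<in> span S" "\<And>w. w \<in> span S \<Longrightarrow> orthogonal z w" "x = y + z"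
    using orthogonal_subspace_decomp_exists[of S x] by blast
  have sp: "span S = S" using assms by (simp add: span_eq_iff)
  show ?thesis
  proof (rule ex1I[of _ z])
    show "z \<in> S\<^sup>\<bottom> \<and> x - z \<in> S"
      using yz sp by (auto simp: orthogonal_comp_def orthogonal_commute)
  next
    fix u assume u: "u \<in> S\<^sup>\<bottom> \<and> x - u \<in> S"
    have "(x - u) - (x - z) \<in> S" using u yz sp subspace_diff[OF assms, of "x - u" "x - z"] by simp
    then have "z - u \<in> S" by simp
    moreover have "z - u \<in> S\<^sup>\<bottom>"
      using u yz sp
      by (auto simp: orthogonal_comp_def orthogonal_def inner_diff_right inner_commute)
    ultimately show "u = z" by (auto simp: orthogonal_comp_def orthogonal_def)
  qed
qed

text \<open>The graph has vertex set \<open>UNIV\<close> and edge relation \<open>E\<close>, symmetric and without loops.\<close>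

definition nbrs :: "('n \<times> 'n) set \<Rightarrow> 'n \<Rightarrow> 'n set" where
  "nbrs E i = {j. (i, j) \<in> E}"

definition connected_graph :: "('n \<times> 'n) set \<Rightarrow> bool" where
  "connected_graph E \<longleftrightarrow> (\<forall>i j. (i, j) \<in> E\<^sup>*)"

definition degree_mat :: "('n::finite \<times> 'n) set \<Rightarrow> real^'n^'n" where
  "degree_mat E = diag_mat (\<lambda>i. real (card (nbrs E i)))"

definition adjacency_mat :: "('n::finite \<times> 'n) set \<Rightarrow> real^'n^'n" where
  "adjacency_mat E = (\<chi> i j. if (i, j) \<in> E then 1 else 0)"

definition laplacian :: "('n::finite \<times> 'n) set \<Rightarrow> real^'n^'n" where
  "laplacian E = degree_mat E - adjacency_mat E"

text \<open>The smallest nonzero eigenvalue.\<close>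

definition lambda2 :: "real^'n^'n \<Rightarrow> real" where
  "lambda2 A = Min (real_eigenvalues A - {0})"

definition max_degree :: "('n::finite \<times> 'n) set \<Rightarrow> nat" where
  "max_degree E = Max (range (\<lambda>i. card (nbrs E i)))"

definition stacked_laplacian :: "('n::finite \<times> 'n) set \<Rightarrow> real^('n \<times> 'n)^('n \<times> 'n)" where
  "stacked_laplacian E = laplacian E \<otimes>\<^sub>K mat 1"

definition block :: "real^('n \<times> 'n) \<Rightarrow> 'n::finite \<Rightarrow> real^'n" where
  "block X i = (\<chi> j. X $ (i, j))"

definition upd :: "real^'n \<Rightarrow> 'n::finite \<Rightarrow> real \<Rightarrow> real^'n" where
  "upd x i t = (\<chi> j. if j = i then t else x $ j)"

text \<open>$\nabla_i J_i(x) = \partial J_i / \partial x_i$, a scalar since the actions are real.\<close>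

definition partial_grad :: "('n::finite \<Rightarrow> real^'n \<Rightarrow> real) \<Rightarrow> 'n \<Rightarrow> real^'n \<Rightarrow> real" where
  "partial_grad J i x = deriv (\<lambda>t. J i (upd x i t)) (x $ i)"

definition pseudo_grad :: "('n::finite \<Rightarrow> real^'n \<Rightarrow> real) \<Rightarrow> real^'n \<Rightarrow> real^'n" where
  "pseudo_grad J x = (\<chi> i. partial_grad J i x)"

definition ext_pseudo_grad :: "('n::finite \<Rightarrow> real^'n \<Rightarrow> real) \<Rightarrow> real^('n \<times> 'n) \<Rightarrow> real^'n" where
  "ext_pseudo_grad J X = (\<chi> i. partial_grad J i (block X i))"

definition ind_fun :: "'a set \<Rightarrow> 'a \<Rightarrow> ereal" where
  "ind_fun S x = (if x \<in> S then 0 else \<infinity>)"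

definition subdifferential :: "('a::real_inner \<Rightarrow> ereal) \<Rightarrow> 'a \<Rightarrow> 'a set" where
  "subdifferential f x = {v. \<bar>f x\<bar> \<noteq> \<infinity> \<and> (\<forall>z. f x + ereal (v \<bullet> (z - x)) \<le> f z)}"

definition normal_cone :: "'a::real_inner set \<Rightarrow> 'a \<Rightarrow> 'a set" where
  "normal_cone S x = {v. x \<in> S \<and> (\<forall>z\<in>S. v \<bullet> (z - x) \<le> 0)}"

lemma subdifferential_ind_fun: "subdifferential (ind_fun S) x = normal_cone S x"
  by (auto simp: subdifferential_def ind_fun_def normal_cone_def zero_ereal_def)

definition G_map :: "('n::finite \<Rightarrow> real set) \<Rightarrow> real^('n \<times> 'n) \<Rightarrow> (real^'n) set" where
  "G_map \<Omega> X = {y. \<forall>i. y $ i \<in> subdifferential (ind_fun (\<Omega> i)) (X $ (i, i))}"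

text \<open>$\mathbf{R} = \mathrm{diag}([e_i])$: the \<open>i\<close>-th diagonal block is the column $e_i$.\<close>

definition R_mat :: "real^'n^('n::finite \<times> 'n)" where
  "R_mat = (\<chi> p k. if fst p = k then axis k 1 $ snd p else 0)"

definition generated_by_algorithm ::
  "('n::finite \<times> 'n) set \<Rightarrow> ('n \<Rightarrow> real set) \<Rightarrow> ('n \<Rightarrow> real^'n \<Rightarrow> real) \<Rightarrow>
   real \<Rightarrow> real \<Rightarrow> ('n \<Rightarrow> real) \<Rightarrow>
   (nat \<Rightarrow> real^('n \<times> 'n)) \<Rightarrow> (nat \<Rightarrow> real^('n \<times> 'n)) \<Rightarrow> bool" where
  "generated_by_algorithm E \<Omega> J c c0 \<beta> x w \<longleftrightarrow>
    (let cbar = c + c0; \<alpha> = (\<lambda>i. \<beta> i + 2 * cbar * real (card (nbrs E i))) in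
     (\<forall>i. x 0 $ (i, i) \<in> \<Omega> i) \<and> w 0 = 0 \<and>
     (\<forall>k\<ge>1. \<forall>i.
        block (w k) i = block (w (k - 1)) i
          + c *\<^sub>R (\<Sum>j\<in>nbrs E i. block (x (k - 1)) i - block (x (k - 1)) j) \<and>
        x k $ (i, i) = closest_point (\<Omega> i)
          (inverse (\<alpha> i) *
            (- partial_grad J i (block (x (k - 1)) i) - w k $ (i, i) + \<beta> i * x (k - 1) $ (i, i)
             + cbar * (\<Sum>j\<in>nbrs E i. x (k - 1) $ (i, i) + x (k - 1) $ (j, i)))) \<and>
        (\<forall>m. m \<noteq> i \<longrightarrow> x k $ (i, m) =
           inverse (\<alpha> i) *
            (\<beta> i * x (k - 1) $ (i, m)
             + cbar * (\<Sum>j\<in>nbrs E i. x (k - 1) $ (i, m) + x (k - 1) $ (j, m)) - w k $ (i, m)))))"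

end

theory Submission
  imports Defs
begin

text \<open>
  Let \<open>z\<close> be the Nash equilibrium. The dual iterates lie in the range of the stacked Laplacian, so
  their columns sum to zero; this forces $F(z) + y^* = 0$ for the limiting normal vector, and the
  limiting dual variable is $0$. With $e_k = \mathbf{x}(k) - \mathbf{1} \otimes z$ and
  $s_k = \sum_{j<k} \mathbf{x}(j)$, so that $\mathbf{w}(k) = c\mathbf{L}s_k$, the function
  $V_k = \|e_k\|_H^2 + c\|s_{k+1}\|_{\mathbf{L}}^2$ satisfies $V_{k+1} \le V_k - \delta a_k$ with
  $a_k = \|e_k\|^2 + \|e_k - e_{k+1}\|^2$: monotonicity restricted to comparisons with a consensus
  vector yields $\bar\mu$, and the condition on $\lambda_{\min}(H)$ makes the remaining quadratic form
  positive definite. The normal cone only enters the diagonal entries of $\mathbf{w}(k+2)$, and these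
  are minus the sum of the other entries of their column, hence $V_{k+1} \le K a_k$ as well. So
  $a_k$ decays geometrically. The residual in the second claim equals $H(e_{k-1} - e_k)$, so both
  quantities are $O(a_{k-1})$, hence $o(1/k)$.
\<close>

section \<open>Symmetric matrices\<close>

lemma symmetric_inner:
  fixes A :: "real^'n^'n"
  assumes "transpose A = A"
  shows "(A *v u) \<bullet> v = u \<bullet> (A *v v)"
  using dot_lmul_matrix[of u A v] transpose_matrix_vector[of A u] assms by simp

text \<open>A minimiser of the Rayleigh quotient over the compact unit sphere of \<open>S\<close> is
  an eigenvector. The invariant subspace stays general: \<open>UNIV\<close> serves
  \<open>lambda_min\<close>, the complement of the kernel serves \<open>lambda2\<close>.\<close>

lemma symmetric_min_eigenvector:
  fixes A :: "real^'n^'n"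
  assumes sym: "transpose A = A" and S: "subspace S" "S \<noteq> {0}"
    and inv: "\<And>v. v \<in> S \<Longrightarrow> A *v v \<in> S"
  obtains m v where "v \<in> S" "v \<noteq> 0" "A *v v = m *\<^sub>R v"
    "\<And>u. u \<in> S \<Longrightarrow> m * (norm u)\<^sup>2 \<le> u \<bullet> (A *v u)"
proof -
  let ?K = "S \<inter> sphere 0 1"
  obtain u0 where u0: "u0 \<in> S" "u0 \<noteq> 0"
    using S subspace_0 by blast
  then have ne: "u0 /\<^sub>R norm u0 \<in> ?K"
    using S by (simp add: subspace_scale)
  have "compact ?K"
    by (simp add: S(1) closed_Int_compact closed_subspace)
  moreover have "continuous_on ?K (\<lambda>u. u \<bullet> (A *v u))"
    by (intro continuous_intros)
  ultimately obtain v where v: "v \<in> ?K" "\<And>u. u \<in> ?K \<Longrightarrow> v \<bullet> (A *v v) \<le> u \<bullet> (A *v u)"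
    using continuous_attains_inf[of ?K "\<lambda>u. u \<bullet> (A *v u)"] ne by blast
  define m where "m = v \<bullet> (A *v v)"
  have min: "m * (norm u)\<^sup>2 \<le> u \<bullet> (A *v u)" if "u \<in> S" for u
  proof (cases "u = 0")
    case False
    then have "u /\<^sub>R norm u \<in> ?K"
      using S that by (simp add: subspace_scale)
    then have "m \<le> (u /\<^sub>R norm u) \<bullet> (A *v (u /\<^sub>R norm u))"
      using v m_def by blast
    also have "\<dots> = (u \<bullet> (A *v u)) / (norm u)\<^sup>2"
      using False by (simp add: matrix_vector_mult_scaleR power2_eq_square field_simps)
    finally show ?thesis
      using False by (simp add: field_simps)
  qed simp
  have vS: "v \<in> S" and v1: "v \<bullet> v = 1"
    using v by (auto simp: norm_eq_1)
  define r where "r = A *v v - m *\<^sub>R v"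
  have rS: "r \<in> S"
    unfolding r_def using vS inv S by (simp add: subspace_diff subspace_scale)
  define q n where "q = r \<bullet> (A *v r) - m * (r \<bullet> r)" and "n = r \<bullet> r"
  have q0: "q \<ge> 0"
    using min[OF rS] by (simp add: q_def power2_norm_eq_inner)
  \<comment> \<open>First variation at \<open>v\<close> along the residual \<open>r\<close>, which
    stays in \<open>S\<close>: the constant term cancels because \<open>v\<close> attains
    \<open>m\<close>, and the linear coefficient is \<open>2 * n\<close>.\<close>
  have quad: "0 \<le> 2 * t * n + t\<^sup>2 * q" for t
  proof -
    have "v + t *\<^sub>R r \<in> S"
      using vS rS S by (simp add: subspace_add subspace_scale)
    from min[OF this] have "0 \<le> (v + t *\<^sub>R r) \<bullet> (A *v (v + t *\<^sub>R r)) - m * ((v + t *\<^sub>R r) \<bullet> (v + t *\<^sub>R r))"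
      by (simp add: power2_norm_eq_inner)
    also have "\<dots> = 2 * t * (r \<bullet> (A *v v) - m * (r \<bullet> v)) + t\<^sup>2 * q"
      using symmetric_inner[OF sym, of v r] v1
      by (simp add: q_def m_def matrix_vector_right_distrib
          matrix_vector_mult_scaleR inner_add_left inner_add_right inner_commute[of v r]
          inner_commute[of "A *v v" r] power2_eq_square algebra_simps)
    also have "r \<bullet> (A *v v) - m * (r \<bullet> v) = n"
      by (simp add: n_def r_def inner_diff_right)
    finally show ?thesis .
  qed
  have "n = 0"
  proof (rule ccontr)
    assume "n \<noteq> 0"
    \<comment> \<open>A step of length \<open>s\<close> against \<open>r\<close>; the denominator
      \<open>q + 1\<close> cannot vanish, and the quadratic collapses to
      \<open>- (s\<^sup>2 * (q + 2))\<close>.\<close>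
    define s where "s = n / (q + 1)"
    have n: "n = s * (q + 1)" using q0 by (simp add: s_def)
    have "0 \<le> 2 * (- s) * n + (- s)\<^sup>2 * q"
      by (rule quad)
    also have "\<dots> = - (s\<^sup>2 * (q + 2))"
      by (subst n) (simp add: power2_eq_square algebra_simps)
    also have "\<dots> < 0"
      using \<open>n \<noteq> 0\<close> q0 n by auto
    finally show False by simp
  qed
  then have "A *v v = m *\<^sub>R v"
    by (simp add: n_def r_def)
  moreover have "v \<noteq> 0" using v1 by auto
  ultimately show ?thesis
    using that vS min by blast
qed

text \<open>The variational eigenvalue makes \<open>real_eigenvalues A\<close> nonempty, so
  \<open>Min\<close> over this finite set is attained; being at most the Rayleigh minimum, it
  inherits the quadratic bound.\<close>

lemma
  fixes A :: "real^'n^'n"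
  assumes "transpose A = A"
  shows lambda_min_in_real_eigenvalues: "lambda_min A \<in> real_eigenvalues A"
    and lambda_min_le: "lambda_min A * (norm u)\<^sup>2 \<le> u \<bullet> (A *v u)"
proof -
  have "UNIV \<noteq> {0 :: real^'n}"
    by (metis UNIV_I nonzero_Basis nonempty_Basis ex_in_conv singletonD)
  then obtain m v where mv: "v \<noteq> 0" "A *v v = m *\<^sub>R v"
      "\<And>u. m * (norm u)\<^sup>2 \<le> u \<bullet> (A *v u)"
    using symmetric_min_eigenvector[OF assms, of UNIV] by (metis UNIV_I subspace_UNIV)
  then have m: "m \<in> real_eigenvalues A"
    by (auto simp: real_eigenvalues_def)
  then show "lambda_min A \<in> real_eigenvalues A"
    unfolding lambda_min_def using Min_in[OF finite_real_eigenvalues[OF assms]] by blast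
  have "lambda_min A \<le> m"
    unfolding lambda_min_def using m finite_real_eigenvalues[OF assms] by simp
  then have "lambda_min A * (norm u)\<^sup>2 \<le> m * (norm u)\<^sup>2"
    by (simp add: mult_right_mono)
  with mv(3)[of u] show "lambda_min A * (norm u)\<^sup>2 \<le> u \<bullet> (A *v u)" by linarith
qed

lemma lambda_min_pos:
  fixes A :: "real^'n^'n"
  assumes "transpose A = A" and "\<And>v. v \<noteq> 0 \<Longrightarrow> v \<bullet> (A *v v) > 0"
  shows "lambda_min A > 0"
proof -
  obtain v where v: "v \<noteq> 0" "A *v v = lambda_min A *\<^sub>R v"
    using lambda_min_in_real_eigenvalues[OF assms(1)] by (auto simp: real_eigenvalues_def)
  then have "lambda_min A * (v \<bullet> v) > 0"
    using assms(2)[of v] by simp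
  moreover have "v \<bullet> v > 0" using v by simp
  ultimately show ?thesis
    using zero_less_mult_pos2 by blast
qed

text \<open>Symmetry puts the range of \<open>A\<close> into the complement of its kernel, so
  Rayleigh minimisation there yields a nonzero eigenvalue; \<open>A \<noteq> 0\<close> makes that
  complement nontrivial.\<close>

lemma
  fixes A :: "real^'n^'n"
  assumes sym: "transpose A = A" and psd: "\<And>v. v \<bullet> (A *v v) \<ge> 0" and "A \<noteq> 0"
  shows lambda2_pos: "lambda2 A > 0"
    and lambda2_le: "u \<in> (kernel A)\<^sup>\<bottom> \<Longrightarrow> lambda2 A * (norm u)\<^sup>2 \<le> u \<bullet> (A *v u)"
proof -
  let ?S = "(kernel A)\<^sup>\<bottom>"
  have inv: "A *v v \<in> ?S" for v
    by (auto simp: orthogonal_comp_def orthogonal_def kernel_def inner_commute[of _ "A *v v"]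
        symmetric_inner[OF sym])
  obtain x where "A *v x \<noteq> 0"
    using \<open>A \<noteq> 0\<close> by (metis matrix_eq matrix_vector_mult_0)
  then have "?S \<noteq> {0}" using inv by blast
  then obtain m v where mv: "v \<in> ?S" "v \<noteq> 0" "A *v v = m *\<^sub>R v"
      "\<And>u. u \<in> ?S \<Longrightarrow> m * (norm u)\<^sup>2 \<le> u \<bullet> (A *v u)"
    using symmetric_min_eigenvector[OF sym subspace_orthogonal_comp] inv by metis
  have "v \<notin> kernel A"
    using mv by (auto simp: orthogonal_comp_def orthogonal_def)
  then have "m \<in> real_eigenvalues A - {0}"
    using mv by (auto simp: real_eigenvalues_def kernel_def)
  moreover have fin: "finite (real_eigenvalues A - {0})"
    using finite_real_eigenvalues[OF sym] by simp
  ultimately have le: "lambda2 A \<le> m" and in2: "lambda2 A \<in> real_eigenvalues A - {0}"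
    unfolding lambda2_def using Min_in[OF fin] by (simp_all only: Min_le) blast
  from in2 obtain z where z: "z \<noteq> 0" "A *v z = lambda2 A *\<^sub>R z" "lambda2 A \<noteq> 0"
    by (auto simp: real_eigenvalues_def)
  then have "lambda2 A * (z \<bullet> z) \<ge> 0"
    using psd[of z] by simp
  moreover have "z \<bullet> z > 0" using z by simp
  ultimately have "lambda2 A \<ge> 0"
    using zero_le_mult_iff not_less by blast
  then show "lambda2 A > 0"
    using z by simp
  assume "u \<in> ?S"
  from mv(4)[OF this] mult_right_mono[OF le, of "(norm u)\<^sup>2"]
  show "lambda2 A * (norm u)\<^sup>2 \<le> u \<bullet> (A *v u)" by simp
qed

text \<open>No spectral decomposition is used: the form is nonnegative at
  \<open>v - (1/M) *\<^sub>R (A *v v)\<close>, and bounding its values at \<open>v\<close> and at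
  \<open>A *v v\<close> from above gives the claim.\<close>

lemma norm_psd_mult_le:
  fixes A :: "real^'n^'n"
  assumes sym: "transpose A = A" and psd: "\<And>v. v \<bullet> (A *v v) \<ge> 0"
    and le: "\<And>v. v \<bullet> (A *v v) \<le> M * (norm v)\<^sup>2" and M: "M > 0"
  shows "norm (A *v v) \<le> M * norm v"
proof -
  let ?a = "A *v v"
  have "0 \<le> (v - (1/M) *\<^sub>R ?a) \<bullet> (A *v (v - (1/M) *\<^sub>R ?a))"
    by (rule psd)
  also have "\<dots> = v \<bullet> ?a - 2 / M * (?a \<bullet> ?a) + (1/M)\<^sup>2 * (?a \<bullet> (A *v ?a))"
    using symmetric_inner[OF sym, of v ?a]
    by (simp add: matrix_vector_mult_diff_distrib matrix_vector_mult_scaleR inner_diff_left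
        inner_diff_right power2_eq_square algebra_simps)
  also have "\<dots> \<le> M * (norm v)\<^sup>2 - 2 / M * (norm ?a)\<^sup>2 + (1/M)\<^sup>2 * (M * (norm ?a)\<^sup>2)"
    using le[of v] mult_left_mono[OF le[of ?a], of "(1/M)\<^sup>2"]
    by (simp add: power2_norm_eq_inner)
  also have "\<dots> = ((M * norm v)\<^sup>2 - (norm ?a)\<^sup>2) / M"
    using M by (simp add: field_simps power2_eq_square)
  finally have "(norm ?a)\<^sup>2 \<le> (M * norm v)\<^sup>2"
    using M by (simp add: zero_le_divide_iff)
  then show ?thesis
    using M by (simp add: abs_le_square_iff[symmetric])
qed

section \<open>Columns of stacked vectors\<close>

text \<open>Column \<open>m\<close> gathers all players' estimates of action \<open>m\<close>.
  \<open>A \<otimes>\<^sub>K mat 1\<close> acts on each column as \<open>A\<close>, which reduces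
  stacked statements to the graph.\<close>

definition col :: "real^('a::finite \<times> 'b::finite) \<Rightarrow> 'b \<Rightarrow> real^'a" where
  "col X m = (\<chi> i. X $ (i, m))"

lemma col_nth [simp]: "col X m $ i = X $ (i, m)"
  by (simp add: col_def)

lemma inner_col: "X \<bullet> Y = (\<Sum>m\<in>UNIV. col X m \<bullet> col Y m)"
proof -
  have "X \<bullet> Y = (\<Sum>i\<in>UNIV. \<Sum>m\<in>UNIV. X $ (i, m) * Y $ (i, m))"
    unfolding inner_vec_def UNIV_Times_UNIV[symmetric] sum.cartesian_product
    by (intro sum.cong) auto
  also have "\<dots> = (\<Sum>m\<in>UNIV. \<Sum>i\<in>UNIV. X $ (i, m) * Y $ (i, m))"
    by (rule sum.swap)
  finally show ?thesis by (simp add: inner_vec_def)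
qed

lemma norm_col: "(norm X)\<^sup>2 = (\<Sum>m\<in>UNIV. (norm (col X m))\<^sup>2)"
  by (simp add: power2_norm_eq_inner inner_col)

lemma kron_mat_1_nth:
  fixes A :: "real^'a^'b" and X :: "real^('a \<times> 'c::finite)"
  shows "((A \<otimes>\<^sub>K mat 1) *v X) $ (i, m) = (A *v col X m) $ i"
proof -
  have "((A \<otimes>\<^sub>K mat 1) *v X) $ (i, m) = (\<Sum>j\<in>UNIV. \<Sum>l\<in>UNIV. A $ i $ j * (mat 1 :: real^'c^'c) $ m $ l * X $ (j, l))"
    unfolding matrix_vector_mult_def kron_def UNIV_Times_UNIV[symmetric] sum.cartesian_product
    by (simp add: split_beta)
  also have "\<dots> = (A *v col X m) $ i"
    by (simp add: matrix_vector_mult_def mat_def if_distrib[of "\<lambda>x. _ * x * _"] cong: if_cong)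
  finally show ?thesis .
qed

lemma col_kron: "col ((A \<otimes>\<^sub>K mat 1) *v X) m = A *v col X m"
  by (simp add: vec_eq_iff kron_mat_1_nth)

lemma transpose_kron_mat_1:
  assumes "transpose A = A"
  shows "transpose (A \<otimes>\<^sub>K mat 1) = A \<otimes>\<^sub>K mat 1"
proof -
  have "A $ i $ j = A $ j $ i" for i j
    using arg_cong[OF assms, of "\<lambda>M. M $ j $ i"] by (simp add: transpose_def)
  then show ?thesis by (auto simp: vec_eq_iff transpose_def kron_def mat_def)
qed

lemma inner_kron: "X \<bullet> ((A \<otimes>\<^sub>K mat 1) *v X) = (\<Sum>m\<in>UNIV. col X m \<bullet> (A *v col X m))"
  by (simp add: inner_col col_kron)

definition consensus :: "real^'n \<Rightarrow> real^('n::finite \<times> 'n)" where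
  "consensus z = (\<chi> p. z $ snd p)"

definition mean :: "real^('n::finite \<times> 'n) \<Rightarrow> real^'n" where
  "mean X = (\<chi> m. (\<Sum>i\<in>UNIV. X $ (i, m)) / real CARD('n))"

text \<open>An explicit form of the component orthogonal to the consensus vectors, free of the
  description operator in \<open>perp_part\<close>.\<close>

definition dev :: "real^('n::finite \<times> 'n) \<Rightarrow> real^('n \<times> 'n)" where
  "dev X = X - consensus (mean X)"

text \<open>The adjoint of \<open>R_mat\<close>, by \<open>inner_R_mat\<close>: it extracts the
  actions actually played.\<close>

definition diagv :: "real^('n::finite \<times> 'n) \<Rightarrow> real^'n" where
  "diagv X = (\<chi> i. X $ (i, i))"

lemma R_mat_nth: "(R_mat *v y) $ (i, m) = (if i = m then y $ m else 0)"
  by (simp add: R_mat_def matrix_vector_mult_def axis_def if_distrib[of "\<lambda>x. x * _"] cong: if_cong)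

lemma inner_R_mat: "X \<bullet> (R_mat *v y) = diagv X \<bullet> y"
proof -
  have "X \<bullet> (R_mat *v y) = (\<Sum>i\<in>UNIV. \<Sum>m\<in>UNIV. X $ (i, m) * (if i = m then y $ m else 0))"
    unfolding inner_vec_def UNIV_Times_UNIV[symmetric] sum.cartesian_product
    by (intro sum.cong) (auto simp: R_mat_nth)
  then show ?thesis
    by (simp add: inner_vec_def diagv_def if_distrib[of "\<lambda>x. _ * x"] cong: if_cong)
qed

lemma diagv_R_mat: "diagv (R_mat *v y) = y"
  by (simp add: diagv_def vec_eq_iff R_mat_nth)

lemma norm_R_mat: "norm (R_mat *v y) = norm y"
  using inner_R_mat[of "R_mat *v y" y] by (simp add: diagv_R_mat norm_eq_sqrt_inner)

lemma norm_diagv: "norm (diagv X) \<le> norm X"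
proof -
  have "(norm (diagv X))\<^sup>2 = X \<bullet> (R_mat *v diagv X)"
    by (simp add: inner_R_mat power2_norm_eq_inner)
  also have "\<dots> \<le> norm X * norm (diagv X)"
    using norm_cauchy_schwarz[of X "R_mat *v diagv X"] by (simp add: norm_R_mat)
  finally show ?thesis
    by (cases "diagv X = 0") (simp_all add: power2_eq_square)
qed

lemma norm_consensus: "(norm (consensus z :: real^('n::finite \<times> 'n)))\<^sup>2 = real CARD('n) * (norm z)\<^sup>2"
  by (simp add: norm_col power2_norm_eq_inner inner_vec_def consensus_def sum_distrib_left)

lemma sum_col_dev: "(\<Sum>i\<in>UNIV. dev X $ (i, m)) = 0"
  by (simp add: dev_def consensus_def mean_def sum_subtractf)

lemma inner_consensus_dev: "consensus z \<bullet> dev X = 0"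
  using sum_col_dev[of X]
  by (simp add: inner_col inner_vec_def consensus_def sum_distrib_left[symmetric])

text \<open>Pythagoras for the consensus splitting. The factor \<open>CARD('n)\<close>, the squared
  norm of the all-ones vector, is the source of the scalings in \<open>\<Psi>\<close>.\<close>

lemma norm_mean_dev:
  fixes X :: "real^('n::finite \<times> 'n)"
  shows "(norm X)\<^sup>2 = real CARD('n) * (norm (mean X))\<^sup>2 + (norm (dev X))\<^sup>2"
proof -
  have X: "X = consensus (mean X) + dev X" by (simp add: dev_def)
  have "(norm X)\<^sup>2 = (norm (consensus (mean X)))\<^sup>2 + (norm (dev X))\<^sup>2"
    by (subst X) (simp add: norm_add_Pythagorean orthogonal_def inner_consensus_dev)
  then show ?thesis by (simp add: norm_consensus)
qed

section \<open>The Laplacian\<close>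

lemma laplacian_mult_nth: "(laplacian E *v v) $ i = (\<Sum>j\<in>nbrs E i. v $ i - v $ j)"
proof -
  have "(\<Sum>j\<in>UNIV. (if i = j then real (card (nbrs E i)) else 0) * v $ j) = (\<Sum>j\<in>nbrs E i. v $ i)"
    by (simp add: if_distrib[of "\<lambda>x. x * _"] cong: if_cong)
  moreover have "(\<Sum>j\<in>UNIV. (if (i, j) \<in> E then 1 else 0) * v $ j) = (\<Sum>j\<in>nbrs E i. v $ j)"
    by (simp add: nbrs_def if_distrib[of "\<lambda>x. x * _"] sum.If_cases cong: if_cong)
  ultimately show ?thesis
    by (simp add: laplacian_def degree_mat_def diag_mat_def adjacency_mat_def
        matrix_vector_mult_def left_diff_distrib sum_subtractf)
qed

lemma laplacian_mult_nth_UNIV: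
  "(laplacian E *v v) $ i = (\<Sum>j\<in>UNIV. if (i, j) \<in> E then v $ i - v $ j else 0)"
  by (simp add: laplacian_mult_nth nbrs_def sum.If_cases)

lemma degree_eq_sum:
  fixes E :: "('n::finite \<times> 'n) set"
  shows "real (card (nbrs E i)) = (\<Sum>j\<in>UNIV. if (i, j) \<in> E then 1 else 0)"
  using sum.inter_filter[of UNIV "\<lambda>_. 1 :: real" "\<lambda>j. (i, j) \<in> E"] by (simp add: nbrs_def)

lemma transpose_laplacian:
  assumes "sym E"
  shows "transpose (laplacian E) = laplacian E"
  using assms by (auto simp: vec_eq_iff transpose_def laplacian_def degree_mat_def diag_mat_def
      adjacency_mat_def sym_def)

lemma sum_edges_swap:
  assumes "sym E"
  shows "(\<Sum>i\<in>UNIV. \<Sum>j\<in>UNIV. if (i, j) \<in> E then f i j else (0::real)) =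
    (\<Sum>i\<in>UNIV. \<Sum>j\<in>UNIV. if (i, j) \<in> E then f j i else 0)"
proof -
  have "(i, j) \<in> E \<longleftrightarrow> (j, i) \<in> E" for i j
    using assms by (auto simp: sym_def)
  then show ?thesis by (subst sum.swap) simp
qed

text \<open>Adding the sum over ordered pairs to its relabelled copy produces squares; each edge is
  met in both orientations, hence the division by 2.\<close>

lemma inner_laplacian:
  assumes "sym E"
  shows "v \<bullet> (laplacian E *v v) =
    (\<Sum>i\<in>UNIV. \<Sum>j\<in>UNIV. if (i, j) \<in> E then (v $ i - v $ j)\<^sup>2 else 0) / 2"
proof -
  define f where "f i j = v $ i * (v $ i - v $ j)" for i j
  have "v \<bullet> (laplacian E *v v) = (\<Sum>i\<in>UNIV. \<Sum>j\<in>UNIV. if (i, j) \<in> E then f i j else 0)"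
    by (simp add: inner_vec_def laplacian_mult_nth_UNIV f_def sum_distrib_left if_distrib[of "\<lambda>x. _ * x"]
        cong: if_cong)
  moreover from this have "v \<bullet> (laplacian E *v v) = (\<Sum>i\<in>UNIV. \<Sum>j\<in>UNIV. if (i, j) \<in> E then f j i else 0)"
    using sum_edges_swap[OF assms] by simp
  ultimately have "2 * (v \<bullet> (laplacian E *v v)) =
      (\<Sum>i\<in>UNIV. \<Sum>j\<in>UNIV. (if (i, j) \<in> E then f i j else 0) + (if (i, j) \<in> E then f j i else 0))"
    by (simp add: sum.distrib)
  also have "\<dots> = (\<Sum>i\<in>UNIV. \<Sum>j\<in>UNIV. if (i, j) \<in> E then (v $ i - v $ j)\<^sup>2 else 0)"
    by (intro sum.cong) (auto simp: f_def power2_eq_square algebra_simps)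
  finally show ?thesis by simp
qed

lemma inner_laplacian_nonneg:
  assumes "sym E"
  shows "v \<bullet> (laplacian E *v v) \<ge> 0"
  by (auto simp: inner_laplacian[OF assms] intro!: sum_nonneg)

text \<open>Each square is at most twice the sum of the squares at its endpoints, and a vertex
  occurs as often as its degree in either role.\<close>

lemma inner_laplacian_le:
  assumes "sym E"
  shows "v \<bullet> (laplacian E *v v) \<le> 2 * real (max_degree E) * (norm v)\<^sup>2"
proof -
  have "2 * (v \<bullet> (laplacian E *v v)) =
      (\<Sum>i\<in>UNIV. \<Sum>j\<in>UNIV. if (i, j) \<in> E then (v $ i - v $ j)\<^sup>2 else 0)"
    by (simp add: inner_laplacian[OF assms])
  also have "\<dots> \<le> (\<Sum>i\<in>UNIV. \<Sum>j\<in>UNIV. 2 * (if (i, j) \<in> E then (v $ i)\<^sup>2 else 0)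
      + 2 * (if (i, j) \<in> E then (v $ j)\<^sup>2 else 0))"
  proof (intro sum_mono)
    fix i j
    have "(v $ i - v $ j)\<^sup>2 \<le> 2 * (v $ i)\<^sup>2 + 2 * (v $ j)\<^sup>2"
      using zero_le_power2[of "v $ i + v $ j"] by (simp add: power2_sum power2_diff)
    then show "(if (i, j) \<in> E then (v $ i - v $ j)\<^sup>2 else 0)
        \<le> 2 * (if (i, j) \<in> E then (v $ i)\<^sup>2 else 0) + 2 * (if (i, j) \<in> E then (v $ j)\<^sup>2 else 0)"
      by simp
  qed
  also have "\<dots> = 4 * (\<Sum>i\<in>UNIV. \<Sum>j\<in>UNIV. if (i, j) \<in> E then (v $ i)\<^sup>2 else 0)"
    using sum_edges_swap[OF assms, of "\<lambda>i j. (v $ i)\<^sup>2"]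
    by (simp add: sum.distrib flip: sum_distrib_left)
  also have "(\<Sum>i\<in>UNIV. \<Sum>j\<in>UNIV. if (i, j) \<in> E then (v $ i)\<^sup>2 else 0) =
      (\<Sum>i\<in>UNIV. real (card (nbrs E i)) * (v $ i)\<^sup>2)"
    by (simp add: degree_eq_sum sum_distrib_right if_distrib[of "\<lambda>x. x * _"] cong: if_cong)
  also have "\<dots> \<le> (\<Sum>i\<in>UNIV. real (max_degree E) * (v $ i)\<^sup>2)"
    by (intro sum_mono mult_right_mono) (simp_all add: max_degree_def)
  also have "\<dots> = real (max_degree E) * (norm v)\<^sup>2"
    by (simp add: norm_eq_sqrt_inner inner_vec_def sum_nonneg power2_eq_square sum_distrib_left)
  finally show ?thesis by simp
qed

text \<open>A vanishing quadratic form forces equality across every edge; connectedness carries it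
  along paths.\<close>

lemma kernel_laplacian_constant:
  assumes "sym E" "connected_graph E" "v \<in> kernel (laplacian E)"
  shows "v $ i = v $ j"
proof -
  have "(\<Sum>i\<in>UNIV. \<Sum>j\<in>UNIV. if (i, j) \<in> E then (v $ i - v $ j)\<^sup>2 else 0) = 0"
    using assms(3) inner_laplacian[OF assms(1), of v] by (simp add: kernel_def)
  then have "\<forall>i. (\<Sum>j\<in>UNIV. if (i, j) \<in> E then (v $ i - v $ j)\<^sup>2 else 0) = 0"
    by (subst (asm) sum_nonneg_eq_0_iff) (auto intro!: sum_nonneg)
  then have "\<forall>i j. (if (i, j) \<in> E then (v $ i - v $ j)\<^sup>2 else 0) = 0"
    by (subst (asm) sum_nonneg_eq_0_iff) auto
  then have edge: "v $ i = v $ j" if "(i, j) \<in> E" for i j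
    using that by (metis eq_iff_diff_eq_0 power_eq_0_iff)
  have "(i, j) \<in> E\<^sup>*"
    using assms(2) by (simp add: connected_graph_def)
  then show ?thesis
    by induction (use edge in auto)
qed

text \<open>Kernel vectors are constant, so the inner product is one entry, read off at an arbitrary
  index, times the sum of \<open>v\<close>.\<close>

lemma sum_zero_in_kernel_laplacian_perp:
  assumes "sym E" "connected_graph E" "(\<Sum>i\<in>UNIV. v $ i) = 0"
  shows "v \<in> (kernel (laplacian E))\<^sup>\<bottom>"
proof -
  have "u \<bullet> v = 0" if u: "u \<in> kernel (laplacian E)" for u
  proof -
    have "u \<bullet> v = (\<Sum>i\<in>UNIV. u $ undefined * v $ i)"
      unfolding inner_vec_def using kernel_laplacian_constant[OF assms(1,2) u] by (intro sum.cong) auto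
    then show ?thesis using assms(3) by (simp flip: sum_distrib_left)
  qed
  then show ?thesis by (auto simp: orthogonal_comp_def orthogonal_def)
qed

lemma laplacian_nonzero:
  assumes "irrefl E" "nbrs E i \<noteq> {}"
  shows "laplacian E \<noteq> 0"
proof -
  obtain j where "(i, j) \<in> E" using assms(2) by (auto simp: nbrs_def)
  moreover from this have "i \<noteq> j" using assms(1) by (auto simp: irrefl_def)
  ultimately have "laplacian E $ i $ j = -1"
    by (simp add: laplacian_def degree_mat_def diag_mat_def adjacency_mat_def)
  then show ?thesis by auto
qed

lemma transpose_stacked_laplacian:
  assumes "sym E"
  shows "transpose (stacked_laplacian E) = stacked_laplacian E"
  unfolding stacked_laplacian_def by (intro transpose_kron_mat_1 transpose_laplacian assms)

lemma stacked_laplacian_mult_nth: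
  "(stacked_laplacian E *v X) $ (i, m) = (\<Sum>j\<in>nbrs E i. X $ (i, m) - X $ (j, m))"
  by (simp add: stacked_laplacian_def kron_mat_1_nth laplacian_mult_nth)

lemma stacked_laplacian_consensus: "stacked_laplacian E *v consensus z = 0"
  by (auto simp: vec_eq_iff stacked_laplacian_mult_nth consensus_def)

lemma stacked_laplacian_dev: "stacked_laplacian E *v dev X = stacked_laplacian E *v X"
  by (simp add: dev_def matrix_vector_mult_diff_distrib stacked_laplacian_consensus)

lemma inner_stacked_laplacian_nonneg:
  assumes "sym E"
  shows "X \<bullet> (stacked_laplacian E *v X) \<ge> 0"
  by (simp add: stacked_laplacian_def inner_kron sum_nonneg inner_laplacian_nonneg[OF assms])

lemma inner_stacked_laplacian_le:
  assumes "sym E"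
  shows "X \<bullet> (stacked_laplacian E *v X) \<le> 2 * real (max_degree E) * (norm X)\<^sup>2"
  by (simp add: stacked_laplacian_def inner_kron norm_col sum_distrib_left sum_mono
      inner_laplacian_le[OF assms])

lemma norm_stacked_laplacian_le:
  assumes "sym E" "max_degree E > 0"
  shows "norm (stacked_laplacian E *v X) \<le> 2 * real (max_degree E) * norm X"
  using assms
  by (intro norm_psd_mult_le transpose_stacked_laplacian inner_stacked_laplacian_nonneg
      inner_stacked_laplacian_le) auto

lemma max_degree_pos:
  assumes "nbrs E i \<noteq> {}"
  shows "max_degree E > 0"
proof -
  have "0 < card (nbrs E i)" using assms by (simp add: card_gt_0_iff)
  also have "\<dots> \<le> max_degree E" by (simp add: max_degree_def)
  finally show ?thesis .
qed

text \<open>The columns of \<open>dev X\<close> sum to zero, so the spectral gap applies column by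
  column; the consensus part is annihilated, so the form at \<open>dev X\<close> is the form at
  \<open>X\<close>.\<close>

lemma lambda2_dev_le:
  assumes "sym E" "irrefl E" "connected_graph E" "nbrs E i \<noteq> {}"
  shows "lambda2 (laplacian E) * (norm (dev X))\<^sup>2 \<le> X \<bullet> (stacked_laplacian E *v X)"
proof -
  have "lambda2 (laplacian E) * (norm (dev X))\<^sup>2 \<le> dev X \<bullet> (stacked_laplacian E *v dev X)"
    unfolding stacked_laplacian_def inner_kron norm_col sum_distrib_left
    using sum_col_dev
    by (intro sum_mono lambda2_le transpose_laplacian inner_laplacian_nonneg
        laplacian_nonzero[OF assms(2,4)] sum_zero_in_kernel_laplacian_perp assms) auto
  also have "\<dots> = X \<bullet> (stacked_laplacian E *v X)"
    using symmetric_inner[OF transpose_stacked_laplacian[OF assms(1)], of "dev X" X]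
      symmetric_inner[OF transpose_stacked_laplacian[OF assms(1)], of X X]
    by (simp add: stacked_laplacian_dev)
  finally show ?thesis .
qed

text \<open>Converts the dual energy of the Lyapunov function into the norm of the dual iterate.
  Cauchy-Schwarz against \<open>dev X\<close>, together with the spectral gap, bounds
  \<open>norm (dev X)\<close> by the norm of the image.\<close>

lemma inner_stacked_laplacian_le_norm:
  assumes "sym E" "irrefl E" "connected_graph E" "nbrs E i \<noteq> {}"
  shows "lambda2 (laplacian E) * (X \<bullet> (stacked_laplacian E *v X)) \<le> (norm (stacked_laplacian E *v X))\<^sup>2"
proof -
  let ?l = "lambda2 (laplacian E)" and ?g = "norm (stacked_laplacian E *v X)"
  let ?q = "X \<bullet> (stacked_laplacian E *v X)"
  have l: "?l > 0"
    by (intro lambda2_pos transpose_laplacian inner_laplacian_nonneg laplacian_nonzero[OF assms(2,4)] assms)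
  have dev: "?l * (norm (dev X))\<^sup>2 \<le> ?q"
    by (rule lambda2_dev_le[OF assms])
  have "?q = dev X \<bullet> (stacked_laplacian E *v X)"
    using symmetric_inner[OF transpose_stacked_laplacian[OF assms(1)], of "dev X" X]
      symmetric_inner[OF transpose_stacked_laplacian[OF assms(1)], of X X]
    by (simp add: stacked_laplacian_dev)
  also have "\<dots> \<le> norm (dev X) * ?g"
    by (rule norm_cauchy_schwarz)
  finally have q: "?q \<le> norm (dev X) * ?g" .
  have "norm (dev X) * (?l * norm (dev X)) \<le> norm (dev X) * ?g"
    using dev q by (simp add: power2_eq_square mult.left_commute)
  then have "?l * norm (dev X) \<le> ?g"
    by (cases "dev X = 0") simp_all
  then have "(?l * norm (dev X)) * ?g \<le> ?g * ?g"
    by (simp add: mult_right_mono)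
  moreover have "?l * ?q \<le> ?l * (norm (dev X) * ?g)"
    using q l by simp
  ultimately show ?thesis by (simp add: power2_eq_square mult.assoc)
qed

text \<open>Lets the final estimates replace the orthogonal component by the iterate itself, as it
  only occurs under \<open>A\<close>.\<close>

lemma perp_part_kernel:
  fixes A :: "real^'m^'m"
  shows "A *v perp_part (kernel A) x = A *v x"
proof -
  have "x - perp_part (kernel A) x \<in> kernel A"
    unfolding perp_part_def using theI'[OF perp_part_unique[OF subspace_kernel]] by blast
  then show ?thesis by (simp add: kernel_def matrix_vector_mult_diff_distrib)
qed

lemma weighted_norm_perp_part:
  fixes A :: "real^'m^'m"
  assumes "transpose A = A" "x \<bullet> (A *v x) \<ge> 0"
  shows "(weighted_norm A (perp_part (kernel A) x))\<^sup>2 = x \<bullet> (A *v x)"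
  using assms symmetric_inner[OF assms(1), of "perp_part (kernel A) x" x] symmetric_inner[OF assms(1), of x x]
  by (simp add: weighted_norm_def perp_part_kernel)

section \<open>Restricted strong monotonicity\<close>

lemma vec2_quadratic_form:
  fixes u :: "real^2"
  shows "u \<bullet> (vector [vector [p, q], vector [q, r]] *v u) = p * (u $ 1)\<^sup>2 + 2 * q * u $ 1 * u $ 2 + r * (u $ 2)\<^sup>2"
  by (simp add: inner_vec_def sum_2 matrix_vector_mult_def power2_eq_square algebra_simps)

lemma transpose_vec2: "transpose (vector [vector [p, q], vector [q, r]] :: real^2^2) = vector [vector [p, q], vector [q, r]]"
  by (simp add: vec_eq_iff forall_2 transpose_def)

lemma lambda_min_2_le:
  "lambda_min (vector [vector [p, q], vector [q, r]] :: real^2^2) * (s\<^sup>2 + t\<^sup>2) \<le> p * s\<^sup>2 + 2 * q * s * t + r * t\<^sup>2"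
  using lambda_min_le[OF transpose_vec2, of p q r "vector [s, t]"]
  by (simp add: vec2_quadratic_form power2_norm_eq_inner) (simp add: inner_vec_def sum_2 power2_eq_square)

text \<open>Multiplying the form by \<open>p\<close> and completing the square exhibits the
  determinant as the remaining coefficient.\<close>

lemma lambda_min_2_pos:
  assumes "p > 0" "p * r > q\<^sup>2"
  shows "lambda_min (vector [vector [p, q], vector [q, r]] :: real^2^2) > 0"
proof (rule lambda_min_pos[OF transpose_vec2])
  fix v :: "real^2" assume "v \<noteq> 0"
  then have ne: "v $ 1 \<noteq> 0 \<or> v $ 2 \<noteq> 0" by (simp add: vec_eq_iff forall_2)
  have "p * (p * (v $ 1)\<^sup>2 + 2 * q * v $ 1 * v $ 2 + r * (v $ 2)\<^sup>2) =
      (p * v $ 1 + q * v $ 2)\<^sup>2 + (p * r - q\<^sup>2) * (v $ 2)\<^sup>2"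
    by (simp add: power2_eq_square algebra_simps)
  also have "\<dots> > 0"
  proof (cases "v $ 2 = 0")
    case True then show ?thesis using ne assms by simp
  next
    case False then show ?thesis using assms by (intro add_nonneg_pos) auto
  qed
  finally show "v \<bullet> (vector [vector [p, q], vector [q, r]] *v v) > 0"
    unfolding vec2_quadratic_form using zero_less_mult_pos assms(1) by blast
qed

lemma ext_pseudo_grad_consensus: "ext_pseudo_grad J (consensus z) = pseudo_grad J z"
proof -
  have "block (consensus z) i = z" for i
    by (simp add: block_def consensus_def)
  then show ?thesis by (simp add: ext_pseudo_grad_def pseudo_grad_def)
qed

text \<open>Both factors are split at the mean: the played actions differ from \<open>z\<close> by
  \<open>d + g\<close>, and the gradients by \<open>p + q\<close>, where \<open>q\<close> compares
  consensus points and \<open>p\<close> is the disagreement error. Strong monotonicity handles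
  \<open>d \<bullet> q\<close>; Cauchy-Schwarz and the Lipschitz bounds handle the other three
  products.\<close>

lemma restricted_monotone:
  fixes X :: "real^('n::finite \<times> 'n)" and FF :: "real^('n \<times> 'n) \<Rightarrow> real^'n"
  defines "F \<equiv> \<lambda>z. FF (consensus z)"
  assumes mono: "\<And>y z. (y - z) \<bullet> (F y - F z) \<ge> \<mu> * (norm (y - z))\<^sup>2"
    and lip: "\<And>y z. norm (F y - F z) \<le> \<theta>0 * norm (y - z)"
    and flip: "\<And>Y Z. norm (FF Y - FF Z) \<le> \<theta> * norm (Y - Z)"
    and nonneg: "\<theta>0 \<ge> 0" "\<theta> \<ge> 0"
  shows "(X - consensus z) \<bullet> (R_mat *v (FF X - F z)) \<ge>
    \<mu> * (norm (mean X - z))\<^sup>2 - (\<theta> + \<theta>0) * norm (mean X - z) * norm (dev X) - \<theta> * (norm (dev X))\<^sup>2"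
proof -
  define d g where "d = mean X - z" and "g = diagv (dev X)"
  define p q where "p = FF X - F (mean X)" and "q = F (mean X) - F z"
  have g: "norm g \<le> norm (dev X)"
    by (simp add: g_def norm_diagv)
  have p: "norm p \<le> \<theta> * norm (dev X)"
    using flip[of X "consensus (mean X)"] by (simp add: p_def F_def dev_def)
  have q: "norm q \<le> \<theta>0 * norm d"
    using lip by (simp add: q_def d_def)
  have "diagv (X - consensus z) = d + g"
    by (simp add: d_def g_def diagv_def dev_def consensus_def vec_eq_iff)
  then have "(X - consensus z) \<bullet> (R_mat *v (FF X - F z)) = (d + g) \<bullet> (p + q)"
    by (simp add: inner_R_mat p_def q_def)
  also have "\<dots> = d \<bullet> q + d \<bullet> p + g \<bullet> p + g \<bullet> q"
    by (simp add: inner_add_left inner_add_right)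
  finally have eq: "(X - consensus z) \<bullet> (R_mat *v (FF X - F z)) = d \<bullet> q + d \<bullet> p + g \<bullet> p + g \<bullet> q" .
  have cs: "a \<bullet> b \<ge> - (A * B)" if "norm a \<le> A" "norm b \<le> B" for a b :: "real^'n" and A B
  proof -
    have "\<bar>a \<bullet> b\<bar> \<le> norm a * norm b" by (rule Cauchy_Schwarz_ineq2)
    also have "\<dots> \<le> A * B"
      using that by (intro mult_mono) (auto intro: order_trans[OF norm_ge_zero])
    finally show ?thesis by simp
  qed
  have "d \<bullet> q \<ge> \<mu> * (norm d)\<^sup>2"
    using mono by (simp add: d_def q_def)
  with cs[OF order_refl p, of d] cs[OF g p] cs[OF g q] show ?thesis
    unfolding eq d_def[symmetric] by (simp add: power2_eq_square algebra_simps)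
qed

section \<open>Existence of the Nash equilibrium\<close>

text \<open>Brouwer's theorem for the projected gradient map \<open>f\<close> on the compact box: at
  a fixed point, the obtuse-angle property of the projection is the variational inequality.\<close>

lemma box_variational_inequality:
  fixes \<Omega> :: "'n::finite \<Rightarrow> real set" and F :: "real^'n \<Rightarrow> real^'n"
  assumes Omega: "\<And>i. \<Omega> i \<noteq> {} \<and> compact (\<Omega> i) \<and> convex (\<Omega> i)"
    and F: "continuous_on UNIV F"
  obtains z where "\<And>i. z $ i \<in> \<Omega> i" "\<And>i t. t \<in> \<Omega> i \<Longrightarrow> - (F z $ i) * (t - z $ i) \<le> 0"
proof -
  define S where "S = {z :: real^'n. \<forall>i. z $ i \<in> \<Omega> i}"
  define f where "f z = (\<chi> i. closest_point (\<Omega> i) (z $ i - F z $ i))" for z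
  have "closed ((\<lambda>z :: real^'n. z $ i) -` \<Omega> i)" for i
    using Omega by (intro continuous_closed_vimage continuous_intros compact_imp_closed) auto
  moreover have "S = (\<Inter>i. (\<lambda>z. z $ i) -` \<Omega> i)" by (auto simp: S_def)
  ultimately have "closed S" by (simp only: closed_INT ball_UNIV simp_thms)
  moreover have "bounded S"
  proof -
    have "\<forall>i. \<exists>B. \<forall>t\<in>\<Omega> i. \<bar>t\<bar> \<le> B"
      using Omega by (metis compact_imp_bounded bounded_iff real_norm_def)
    then obtain B where B: "\<And>i t. t \<in> \<Omega> i \<Longrightarrow> \<bar>t\<bar> \<le> B i" by metis
    have "norm z \<le> (\<Sum>i\<in>UNIV. B i)" if "z \<in> S" for z
      using that B by (intro order_trans[OF norm_le_l1_cart] sum_mono) (auto simp: S_def)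
    then show ?thesis by (auto simp: bounded_iff)
  qed
  ultimately have "compact S" by (simp add: compact_eq_bounded_closed)
  moreover have "convex S"
    using Omega by (auto simp: S_def convex_def)
  moreover have "S \<noteq> {}"
  proof -
    have "(\<chi> i. SOME t. t \<in> \<Omega> i) \<in> S"
      using Omega by (simp add: S_def some_in_eq)
    then show ?thesis by blast
  qed
  moreover have "continuous_on S f"
    unfolding f_def
  proof (intro continuous_intros)
    fix i
    have "continuous_on UNIV (closest_point (\<Omega> i))"
      using Omega by (intro continuous_on_closest_point) (auto intro: compact_imp_closed)
    moreover have "continuous_on S (\<lambda>z. z $ i - F z $ i)"
      by (intro continuous_intros continuous_on_subset[OF F]) auto
    ultimately show "continuous_on S (\<lambda>z. closest_point (\<Omega> i) (z $ i - F z $ i))"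
      using continuous_on_compose2[of UNIV "closest_point (\<Omega> i)" S "\<lambda>z. z $ i - F z $ i"] by simp
  qed
  moreover have "f \<in> S \<rightarrow> S"
    using Omega by (auto simp: S_def f_def closest_point_in_set compact_imp_closed)
  ultimately obtain z where z: "z \<in> S" "f z = z"
    using brouwer[of S f] by blast
  show ?thesis
  proof
    show "z $ i \<in> \<Omega> i" for i using z by (simp add: S_def)
    fix i t assume t: "t \<in> \<Omega> i"
    have "closest_point (\<Omega> i) (z $ i - F z $ i) = z $ i"
      using arg_cong[OF z(2), of "\<lambda>v. v $ i"] by (simp add: f_def)
    then show "- (F z $ i) * (t - z $ i) \<le> 0"
      using closest_point_dot[of "\<Omega> i" t "z $ i - F z $ i"] Omega t
      by (simp add: compact_imp_closed)
  qed
qed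

section \<open>The iteration\<close>

lemma preconditioner_mult_nth:
  assumes "H = diag_mat \<beta> + (2 * cbar) *\<^sub>R degree_mat E - c *\<^sub>R laplacian E"
  shows "((H \<otimes>\<^sub>K mat 1) *v X) $ (i, m) =
    (\<beta> i + 2 * cbar * real (card (nbrs E i))) * X $ (i, m) - c * (stacked_laplacian E *v X) $ (i, m)"
proof -
  have diag: "(diag_mat d *v v) $ i = d i * v $ i" for d :: "'a \<Rightarrow> real" and v
    by (simp add: diag_mat_def matrix_vector_mult_def if_distrib[of "\<lambda>x. x * _"] cong: if_cong)
  show ?thesis
    by (simp add: kron_mat_1_nth assms stacked_laplacian_def matrix_vector_mult_diff_rdistrib
        matrix_vector_mult_add_rdistrib scaleR_matrix_vector_assoc[symmetric] degree_mat_def diag algebra_simps)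
qed

text \<open>Multiplying the primal update by \<open>\<alpha> i\<close> leaves
  \<open>w (Suc k)\<close> and the Laplacian term with coefficient \<open>c + c0\<close>. The part
  \<open>- c *\<^sub>R laplacian E\<close> of \<open>H\<close> moves \<open>c\<close> times this
  term to \<open>x (Suc k)\<close>, which advances the dual variable to
  \<open>w (Suc (Suc k))\<close> and leaves only \<open>c0\<close>.\<close>

lemma
  fixes E :: "('n::finite \<times> 'n) set"
  assumes gen: "generated_by_algorithm E \<Omega> J c c0 \<beta> x w"
    and Omega: "\<And>i. \<Omega> i \<noteq> {} \<and> compact (\<Omega> i) \<and> convex (\<Omega> i)"
    and pos: "\<And>i. \<beta> i > 0" "c \<ge> 0" "c0 \<ge> 0"
    and H: "H = diag_mat \<beta> + (2 * (c + c0)) *\<^sub>R degree_mat E - c *\<^sub>R laplacian E"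
  shows dual_step: "w (Suc k) = w k + c *\<^sub>R (stacked_laplacian E *v x k)"
    and primal_step: "\<exists>y\<in>G_map \<Omega> (x (Suc k)).
      (H \<otimes>\<^sub>K mat 1) *v (x k - x (Suc k)) =
        R_mat *v (ext_pseudo_grad J (x k) + y) + w (Suc (Suc k)) + c0 *\<^sub>R (stacked_laplacian E *v x k)"
proof -
  define \<alpha> where "\<alpha> i = \<beta> i + 2 * (c + c0) * real (card (nbrs E i))" for i
  define s where "s k i m = (\<Sum>j\<in>nbrs E i. x k $ (i, m) + x k $ (j, m))" for k i m
  define t where "t k i = inverse (\<alpha> i) * (- partial_grad J i (block (x k) i) - w (Suc k) $ (i, i)
      + \<beta> i * x k $ (i, i) + (c + c0) * s k i i)" for k i
  have gen': "\<forall>k\<ge>1. \<forall>i.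
        block (w k) i = block (w (k - 1)) i
          + c *\<^sub>R (\<Sum>j\<in>nbrs E i. block (x (k - 1)) i - block (x (k - 1)) j) \<and>
        x k $ (i, i) = closest_point (\<Omega> i)
          (inverse (\<alpha> i) *
            (- partial_grad J i (block (x (k - 1)) i) - w k $ (i, i) + \<beta> i * x (k - 1) $ (i, i)
             + (c + c0) * s (k - 1) i i)) \<and>
        (\<forall>m. m \<noteq> i \<longrightarrow> x k $ (i, m) =
           inverse (\<alpha> i) *
            (\<beta> i * x (k - 1) $ (i, m)
             + (c + c0) * s (k - 1) i m - w k $ (i, m)))"
    using gen unfolding generated_by_algorithm_def Let_def \<alpha>_def s_def by blast
  have step: "block (w (Suc k)) i = block (w k) i + c *\<^sub>R (\<Sum>j\<in>nbrs E i. block (x k) i - block (x k) j)"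
    and step_diag: "x (Suc k) $ (i, i) = closest_point (\<Omega> i) (t k i)"
    and step_off: "m \<noteq> i \<Longrightarrow> x (Suc k) $ (i, m) = inverse (\<alpha> i) *
      (\<beta> i * x k $ (i, m) + (c + c0) * s k i m - w (Suc k) $ (i, m))" for k i m
    using gen'[rule_format, of "Suc k" i] by (simp_all add: t_def)
  have dual: "w (Suc k) = w k + c *\<^sub>R (stacked_laplacian E *v x k)" for k
  proof -
    have "w (Suc k) $ (i, m) = (w k + c *\<^sub>R (stacked_laplacian E *v x k)) $ (i, m)" for i m
      using arg_cong[OF step[of k i], of "\<lambda>v. v $ m"] by (simp add: block_def stacked_laplacian_mult_nth)
    then show ?thesis by (auto simp: vec_eq_iff)
  qed
  then show "w (Suc k) = w k + c *\<^sub>R (stacked_laplacian E *v x k)" .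
  have \<alpha>: "\<alpha> i > 0" for i
    using pos by (simp add: \<alpha>_def add_pos_nonneg)
  have s: "s k i m = 2 * real (card (nbrs E i)) * x k $ (i, m) - (stacked_laplacian E *v x k) $ (i, m)" for k i m
    by (simp add: s_def stacked_laplacian_mult_nth sum.distrib sum_subtractf)
  \<comment> \<open>The projection residual is a normal vector at the projected point; the factor
    \<open>\<alpha> i\<close> matches the rescaled update.\<close>
  define y :: "real^'n" where "y = (\<chi> i. \<alpha> i * (t k i - x (Suc k) $ (i, i)))"
  have "y $ i \<in> normal_cone (\<Omega> i) (x (Suc k) $ (i, i))" for i
  proof -
    have "\<alpha> i * ((t k i - x (Suc k) $ (i, i)) * (z - x (Suc k) $ (i, i))) \<le> 0" if "z \<in> \<Omega> i" for z
      using closest_point_dot[of "\<Omega> i" z "t k i"] Omega[of i] that \<alpha>[of i]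
      by (simp add: step_diag compact_imp_closed mult_nonneg_nonpos)
    moreover have "x (Suc k) $ (i, i) \<in> \<Omega> i"
      using Omega[of i] by (simp add: step_diag closest_point_in_set compact_imp_closed)
    ultimately show ?thesis
      by (simp add: normal_cone_def y_def mult.assoc)
  qed
  then have "y \<in> G_map \<Omega> (x (Suc k))"
    by (simp add: G_map_def subdifferential_ind_fun)
  moreover have "((H \<otimes>\<^sub>K mat 1) *v (x k - x (Suc k))) $ (i, m) =
      (R_mat *v (ext_pseudo_grad J (x k) + y) + w (Suc (Suc k)) + c0 *\<^sub>R (stacked_laplacian E *v x k)) $ (i, m)" for i m
  proof (cases "i = m")
    case True
    have "\<alpha> m * t k m = - partial_grad J m (block (x k) m) - w (Suc k) $ (m, m)
      + \<beta> m * x k $ (m, m) + (c + c0) * s k m m"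
      using \<alpha>[of m] by (simp add: t_def)
    then show ?thesis
      using True
      by (simp add: preconditioner_mult_nth[OF H] R_mat_nth ext_pseudo_grad_def y_def dual[of "Suc k"]
          right_diff_distrib[of "\<alpha> m"] s matrix_vector_mult_diff_distrib)
        (simp add: \<alpha>_def algebra_simps)
  next
    case False
    have "\<alpha> i * x (Suc k) $ (i, m) = \<beta> i * x k $ (i, m) + (c + c0) * s k i m - w (Suc k) $ (i, m)"
      using \<alpha>[of i] False by (simp add: step_off)
    then show ?thesis
      using False
      by (simp add: preconditioner_mult_nth[OF H] R_mat_nth dual[of "Suc k"] s matrix_vector_mult_diff_distrib)
        (simp add: \<alpha>_def algebra_simps)
  qed
  ultimately show "\<exists>y\<in>G_map \<Omega> (x (Suc k)). (H \<otimes>\<^sub>K mat 1) *v (x k - x (Suc k)) =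
      R_mat *v (ext_pseudo_grad J (x k) + y) + w (Suc (Suc k)) + c0 *\<^sub>R (stacked_laplacian E *v x k)"
    by (auto simp: vec_eq_iff)
qed

lemma normal_cone_monotone:
  fixes a b :: real
  assumes "u \<in> normal_cone S a" "v \<in> normal_cone S b"
  shows "(u - v) * (a - b) \<ge> 0"
proof -
  have "u * (b - a) \<le> 0" "v * (a - b) \<le> 0"
    using assms by (auto simp: normal_cone_def)
  then show ?thesis by (simp add: algebra_simps)
qed

section \<open>Linear convergence\<close>

lemma square_add_le: "(a + b)\<^sup>2 \<le> 2 * (a\<^sup>2 + b\<^sup>2)" for a b :: real
  using zero_le_power2[of "a - b"] by (simp add: power2_sum power2_diff)

text \<open>A column sum is an inner product with a consensus vector, and the symmetric Laplacian
  kills that vector.\<close>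

lemma sum_col_stacked_laplacian:
  assumes "sym E"
  shows "(\<Sum>i\<in>UNIV. (stacked_laplacian E *v X) $ (i, m)) = 0"
proof -
  have "(\<Sum>i\<in>UNIV. (stacked_laplacian E *v X) $ (i, m)) = (stacked_laplacian E *v X) \<bullet> consensus (axis m 1)"
    by (simp add: inner_col inner_vec_def consensus_def axis_def if_distrib[of "\<lambda>x. _ * x"]
        if_distrib[of "sum _"] sum.If_cases cong: if_cong)
  also have "\<dots> = 0"
    using symmetric_inner[OF transpose_stacked_laplacian[OF assms]] by (simp add: stacked_laplacian_consensus)
  finally show ?thesis .
qed

text \<open>Since the columns of the dual vector sum to zero, its diagonal entries, the only ones touched by
  the normal cone, are controlled by the others.\<close>

lemma norm_dual_le:
  fixes W g :: "real^('n::finite \<times> 'n)"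
  assumes W: "W = g - R_mat *v v" and sum: "\<And>m. (\<Sum>i\<in>UNIV. W $ (i, m)) = 0"
  shows "norm W \<le> real CARD('n \<times> 'n) * real CARD('n) * norm g"
proof -
  have off: "\<bar>W $ (i, m)\<bar> \<le> norm g" if "i \<noteq> m" for i m
    using that Finite_Cartesian_Product.norm_nth_le[of g "(i, m)"] by (simp add: W R_mat_nth)
  have "\<bar>W $ (i, m)\<bar> \<le> real CARD('n) * norm g" for i m
  proof (cases "i = m")
    case True
    have "W $ (m, m) = - (\<Sum>i\<in>UNIV - {m}. W $ (i, m))"
      using sum[of m] by (simp add: sum.remove[of UNIV m])
    then have "\<bar>W $ (m, m)\<bar> \<le> (\<Sum>i\<in>UNIV - {m}. \<bar>W $ (i, m)\<bar>)"
      by (simp add: sum_abs)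
    also have "\<dots> \<le> (\<Sum>i\<in>UNIV - {m}. norm g)"
      using off by (intro sum_mono) auto
    also have "\<dots> \<le> (\<Sum>i\<in>(UNIV :: 'n set). norm g)"
      by (intro sum_mono2) auto
    finally show ?thesis using True by simp
  next
    case False
    have "1 * norm g \<le> real CARD('n) * norm g"
      by (intro mult_right_mono) (simp_all add: Suc_leI)
    with off[OF False] show ?thesis by simp
  qed
  then have "norm W \<le> (\<Sum>p\<in>(UNIV :: ('n \<times> 'n) set). real CARD('n) * norm g)"
    by (intro order_trans[OF norm_le_l1_cart] sum_mono) auto
  then show ?thesis by simp
qed

text \<open>Pair \<open>eq\<close> with \<open>2 * e1\<close>; polarisation turns the
  \<open>HH\<close> and \<open>LL\<close> terms into differences of energies. Since \<open>A\<close>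
  is controlled at the old error \<open>e0\<close>, passing to \<open>e1\<close> costs the cross
  term in \<open>t\<close>, which \<open>l\<close> has to absorb.\<close>

lemma lyapunov_step:
  fixes HH LL :: "real^'m^'m"
  assumes sym: "transpose HH = HH" "transpose LL = LL"
    and psd: "\<And>v. v \<bullet> (LL *v v) \<ge> 0" and HH: "\<And>v. v \<bullet> (HH *v v) \<ge> l * (norm v)\<^sup>2"
    and eq: "HH *v (e0 - e1) = A + r + c *\<^sub>R (LL *v s1)"
    and r: "r \<bullet> e1 \<ge> 0" and s: "LL *v e1 = LL *v (s1 - s0)"
    and A: "A \<bullet> e0 \<ge> \<mu> * (norm e0)\<^sup>2" "norm A \<le> t * norm e0" and c: "c \<ge> 0"
  shows "e1 \<bullet> (HH *v e1) + c * (s1 \<bullet> (LL *v s1)) \<le> e0 \<bullet> (HH *v e0) + c * (s0 \<bullet> (LL *v s0))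
    - (2 * \<mu> * (norm e0)\<^sup>2 + 2 * (- t) * norm e0 * norm (e0 - e1) + l * (norm (e0 - e1))\<^sup>2)"
proof -
  let ?d = "e0 - e1"
  have polar: "2 * ((M *v (a - b)) \<bullet> b) = a \<bullet> (M *v a) - b \<bullet> (M *v b) - (a - b) \<bullet> (M *v (a - b))"
    if "transpose M = M" for M :: "real^'m^'m" and a b
    using symmetric_inner[OF that, of a b] symmetric_inner[OF that, of b b]
    by (simp add: matrix_vector_mult_diff_distrib inner_diff_left inner_diff_right inner_commute[of b "M *v a"])
  \<comment> \<open>Under \<open>LL\<close>, \<open>e1\<close> is the increment
    \<open>s1 - s0\<close>; the form at this increment is the nonnegative surplus dropped
    below.\<close>
  have "2 * ((LL *v s1) \<bullet> e1) = 2 * ((LL *v (s1 - s0)) \<bullet> s0) + 2 * ((LL *v (s1 - s0)) \<bullet> (s1 - s0))"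
    using symmetric_inner[OF sym(2), of s1 e1] s by (simp add: inner_diff_right inner_commute[of s1])
  also have "\<dots> = s1 \<bullet> (LL *v s1) - s0 \<bullet> (LL *v s0) + (s1 - s0) \<bullet> (LL *v (s1 - s0))"
    unfolding polar[OF sym(2)] by (simp add: inner_commute)
  finally have "2 * ((LL *v s1) \<bullet> e1) \<ge> s1 \<bullet> (LL *v s1) - s0 \<bullet> (LL *v s0)"
    using psd[of "s1 - s0"] by linarith
  from mult_left_mono[OF this c]
  have dual: "2 * (c * ((LL *v s1) \<bullet> e1)) \<ge> c * (s1 \<bullet> (LL *v s1)) - c * (s0 \<bullet> (LL *v s0))"
    by (simp add: algebra_simps)
  have "A \<bullet> ?d \<le> norm A * norm ?d"
    by (rule norm_cauchy_schwarz)
  also have "\<dots> \<le> t * norm e0 * norm ?d"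
    using A by (simp add: mult_right_mono)
  finally have "A \<bullet> e1 \<ge> \<mu> * (norm e0)\<^sup>2 - t * norm e0 * norm ?d"
    using A by (simp add: inner_diff_right)
  moreover have "2 * ((HH *v ?d) \<bullet> e1) = e0 \<bullet> (HH *v e0) - e1 \<bullet> (HH *v e1) - ?d \<bullet> (HH *v ?d)"
    by (rule polar[OF sym(1)])
  moreover have "(HH *v ?d) \<bullet> e1 = A \<bullet> e1 + r \<bullet> e1 + c * ((LL *v s1) \<bullet> e1)"
    by (simp add: eq inner_add_left)
  ultimately show ?thesis
    using dual r HH[of ?d] by simp
qed

text \<open>Adding \<open>K\<close> times the decrease to \<open>\<delta>\<close> times the upper
  bound eliminates \<open>a k\<close> and contracts \<open>V\<close> by
  \<open>K / (K + \<delta>)\<close>; the decrease then bounds \<open>a k\<close> by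
  \<open>V k / \<delta>\<close>.\<close>

lemma lyapunov_geometric:
  fixes V a :: "nat \<Rightarrow> real"
  assumes pos: "\<delta> > 0" "K > 0" and V: "\<And>k. V k \<ge> 0"
    and dec: "\<And>k. V (Suc k) \<le> V k - \<delta> * a k" and le: "\<And>k. V (Suc k) \<le> K * a k"
  obtains r C where "0 \<le> r" "r < 1" "\<And>k. a k \<le> C * r ^ k"
proof -
  define r where "r = K / (K + \<delta>)"
  have r: "0 \<le> r" "r < 1" using pos by (auto simp: r_def)
  have step: "V (Suc k) \<le> r * V k" for k
  proof -
    have "\<delta> * V (Suc k) \<le> \<delta> * (K * a k)" "K * V (Suc k) \<le> K * (V k - \<delta> * a k)"
      using le dec pos by (auto intro!: mult_left_mono)
    then have "(K + \<delta>) * V (Suc k) \<le> K * V k"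
      by (simp add: algebra_simps)
    then show ?thesis
      using pos by (simp add: r_def field_simps)
  qed
  have geo: "V k \<le> V 0 * r ^ k" for k
  proof (induction k)
    case (Suc k)
    have "V (Suc k) \<le> r * V k" by (rule step)
    also have "\<dots> \<le> r * (V 0 * r ^ k)" by (rule mult_left_mono[OF Suc r(1)])
    finally show ?case by (simp add: algebra_simps)
  qed simp
  have "a k \<le> V 0 / \<delta> * r ^ k" for k
  proof -
    have "\<delta> * a k \<le> V 0 * r ^ k"
      using dec[of k] V[of "Suc k"] geo[of k] by simp
    then show ?thesis using pos by (simp add: field_simps)
  qed
  then show ?thesis using that r by blast
qed

text \<open>The shifted index fits both residuals, which are bounded through data of the preceding
  iteration.\<close>

lemma geometric_smallo:
  fixes f :: "nat \<Rightarrow> real"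
  assumes r: "0 \<le> r" "r < 1" and f: "\<And>k. 0 \<le> f (Suc k)" "\<And>k. f (Suc k) \<le> C * r ^ k"
  shows "f \<in> o(\<lambda>k. 1 / real k)"
proof (rule smalloI_tendsto)
  have "(\<lambda>k. C * (real k * r ^ k) + C * r ^ k) \<longlonglongrightarrow> C * 0 + C * 0"
    using r by (intro tendsto_intros powser_times_n_limit_0 LIMSEQ_realpow_zero) auto
  then have lim: "(\<lambda>k. C * (real k * r ^ k) + C * r ^ k) \<longlonglongrightarrow> 0" by simp
  have bound: "norm (f (Suc k) / (1 / real (Suc k))) \<le> C * (real k * r ^ k) + C * r ^ k" for k
    using mult_right_mono[OF f(2), of "real (Suc k)" k] f(1)[of k] by (simp add: abs_mult algebra_simps)
  have "(\<lambda>k. f (Suc k) / (1 / real (Suc k))) \<longlonglongrightarrow> 0"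
    by (rule Lim_null_comparison[OF _ lim]) (intro always_eventually allI bound)
  then show "(\<lambda>k. f k / (1 / real k)) \<longlonglongrightarrow> 0"
    by (subst (asm) filterlim_sequentially_Suc)
  \<comment> \<open>Only eventually, because \<open>1 / real 0\<close> is 0.\<close>
  show "eventually (\<lambda>k. 1 / real k \<noteq> 0) sequentially"
    using eventually_gt_at_top[of 0] by eventually_elim simp
qed

text \<open>Coercivity makes \<open>M\<close> injective and hence invertible, so the inverse weight
  cancels against a residual of the form \<open>M *v v\<close>.\<close>

lemma weighted_norm_matrix_inv:
  fixes M :: "real^'m^'m"
  assumes "l > 0" "\<And>v. v \<bullet> (M *v v) \<ge> l * (norm v)\<^sup>2"
  shows "(weighted_norm (matrix_inv M) (M *v v))\<^sup>2 = v \<bullet> (M *v v)"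
proof -
  have "v = 0" if "M *v v = 0" for v
    using assms(2)[of v] assms(1) that by (simp add: mult_le_0_iff)
  then have "inj ((*v) M)"
    by (intro linear_injective_0[THEN iffD2]) (auto intro: matrix_vector_mul_linear)
  then have "invertible M"
    by (simp add: invertible_left_inverse matrix_left_invertible_injective)
  then have "matrix_inv M ** M = mat 1"
    unfolding invertible_def matrix_inv_def by (metis (mono_tags, lifting) someI_ex)
  then have "matrix_inv M *v (M *v v) = v"
    by (simp add: matrix_vector_mul_assoc)
  moreover have "v \<bullet> (M *v v) \<ge> 0"
    using assms by (meson mult_nonneg_nonneg less_imp_le order_trans zero_le_power2)
  ultimately show ?thesis
    by (simp add: weighted_norm_def inner_commute)
qed

theorem theorem2:
  fixes \<Omega> :: "'n::finite \<Rightarrow> real set"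
    and J :: "'n \<Rightarrow> real^'n \<Rightarrow> real"
    and E :: "('n \<times> 'n) set"
    and \<mu> \<theta>0 \<theta> c c0 cmin cbar \<mu>bar \<theta>bar :: real
    and \<beta> :: "'n \<Rightarrow> real"
    and \<Psi> :: "real^2^2"
    and H L :: "real^'n^'n"
    and LL :: "real^('n \<times> 'n)^('n \<times> 'n)"
    and x w xperp :: "nat \<Rightarrow> real^('n \<times> 'n)"
  assumes Omega: "\<And>i. \<Omega> i \<noteq> {} \<and> compact (\<Omega> i) \<and> convex (\<Omega> i)"
    and J_C1: "\<And>i z. (\<lambda>t. J i (upd z i t)) C1_differentiable_on UNIV"
    and J_convex: "\<And>i z. convex_on UNIV (\<lambda>t. J i (upd z i t))"
    and J_cont: "\<And>i. continuous_on UNIV (J i)"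
    and mu_pos: "\<mu> > 0"
    and theta0_pos: "\<theta>0 > 0"
    and strongly_monotone:
      "\<And>y z. (y - z) \<bullet> (pseudo_grad J y - pseudo_grad J z) \<ge> \<mu> * (norm (y - z))\<^sup>2"
    and F_lipschitz: "\<And>y z. norm (pseudo_grad J y - pseudo_grad J z) \<le> \<theta>0 * norm (y - z)"
    and E_undirected: "sym E" and E_loopfree: "irrefl E"
    and E_connected: "connected_graph E"
    and E_no_isolated: "\<And>i. nbrs E i \<noteq> {}"
    and theta_pos: "\<theta> > 0"
    and FF_lipschitz:
      "\<And>Y Z. norm (ext_pseudo_grad J Y - ext_pseudo_grad J Z) \<le> \<theta> * norm (Y - Z)"
    and L_eq: "L = laplacian E"
    and LL_eq: "LL = stacked_laplacian E"
    and c_pos: "c > 0"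
    and cmin_eq: "cmin * lambda2 L = (\<theta> + \<theta>0)\<^sup>2 / (4 * \<mu>) + \<theta>"
    and c0_gt: "c0 > cmin"
    and cbar_eq: "cbar = c + c0"
    and Psi_eq: "\<Psi> = vector
        [vector [\<mu> / real CARD('n), - (\<theta> + \<theta>0) / (2 * sqrt (real CARD('n)))],
         vector [- (\<theta> + \<theta>0) / (2 * sqrt (real CARD('n))), c0 * lambda2 L - \<theta>]]"
    and mubar_eq: "\<mu>bar = lambda_min \<Psi>"
    and thetabar_eq: "\<theta>bar = \<theta> + 2 * c0 * real (max_degree E)"
    and beta_pos: "\<And>i. \<beta> i > 0"
    and H_eq: "H = diag_mat \<beta> + (2 * cbar) *\<^sub>R degree_mat E - c *\<^sub>R L"
    and H_cond: "lambda_min H > \<theta>bar\<^sup>2 / (2 * \<mu>bar)"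
    and algorithm: "generated_by_algorithm E \<Omega> J c c0 \<beta> x w"
    and xperp_eq: "\<And>k. xperp k = perp_part (kernel LL) (x k)"
  shows "(\<lambda>k. (weighted_norm LL (xperp k))\<^sup>2) \<in> o(\<lambda>k. 1 / real k)
    \<and> (\<exists>y. (\<forall>k\<ge>1. y k \<in> G_map \<Omega> (x k)) \<and>
         (\<lambda>k. (weighted_norm (matrix_inv (H \<otimes>\<^sub>K (mat 1 :: real^'n^'n)))
                 (R_mat *v (ext_pseudo_grad J (x (k - 1)) + y k) + w (k + 1)
                  + c0 *\<^sub>R (LL *v xperp (k - 1))))\<^sup>2) \<in> o(\<lambda>k. 1 / real k))"
proof -

  \<comment> \<open>Positivity of the constants and bounds on the weight matrix\<close>
  let ?N = "real CARD('n)" and ?l = "lambda2 L" and ?FF = "ext_pseudo_grad J" and ?d = "real (max_degree E)"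
  have N: "?N > 0" by simp
  have LL_sym: "transpose LL = LL" and LL_nonneg: "\<And>v. v \<bullet> (LL *v v) \<ge> 0"
    unfolding LL_eq
    by (simp_all add: transpose_stacked_laplacian inner_stacked_laplacian_nonneg E_undirected)
  have l: "?l > 0"
    unfolding L_eq
    by (intro lambda2_pos transpose_laplacian inner_laplacian_nonneg E_undirected
        laplacian_nonzero[OF E_loopfree E_no_isolated])
  \<comment> \<open>\<open>cmin\<close> is given only through this product, so its sign, and with it
    that of \<open>c0\<close>, comes from the sign of \<open>lambda2 L\<close>.\<close>
  have "cmin * ?l > 0"
    using cmin_eq mu_pos theta_pos by (simp add: add_nonneg_pos)
  then have c0_pos: "c0 > 0"
    using l c0_gt zero_less_mult_pos2 by fastforce
  have gap: "c0 * ?l - \<theta> > (\<theta> + \<theta>0)\<^sup>2 / (4 * \<mu>)"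
    using mult_strict_right_mono[OF c0_gt l] cmin_eq by simp

  \<comment> \<open>The off-diagonal entry of \<open>\<Psi>\<close>. The determinant of
    \<open>\<Psi>\<close> is positive exactly when \<open>gap\<close> holds, that is, when
    \<open>c0\<close> exceeds \<open>cmin\<close>.\<close>
  define q where "q = - (\<theta> + \<theta>0) / (2 * sqrt ?N)"
  have "q\<^sup>2 = \<mu> / ?N * ((\<theta> + \<theta>0)\<^sup>2 / (4 * \<mu>))"
    using mu_pos N by (simp add: q_def power_divide power_mult_distrib power2_minus del: minus_add_distrib)
  also have "\<dots> < \<mu> / ?N * (c0 * ?l - \<theta>)"
    using gap mu_pos N by (intro mult_strict_left_mono) auto
  finally have mubar_pos: "\<mu>bar > 0"
    unfolding mubar_eq Psi_eq q_def[symmetric] using mu_pos by (intro lambda_min_2_pos) auto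

  have H_sym: "transpose H = H"
    using arg_cong[OF transpose_laplacian[OF E_undirected], of "\<lambda>M. M $ i $ j" for i j]
    by (auto simp: H_eq L_eq vec_eq_iff transpose_def diag_mat_def degree_mat_def)
  define HH where "HH = H \<otimes>\<^sub>K (mat 1 :: real^'n^'n)"
  have HH_sym: "transpose HH = HH"
    unfolding HH_def by (rule transpose_kron_mat_1[OF H_sym])
  have HH_ge: "v \<bullet> (HH *v v) \<ge> lambda_min H * (norm v)\<^sup>2" for v
    by (simp add: HH_def inner_kron norm_col sum_distrib_left sum_mono
        lambda_min_le[OF H_sym])
  have "0 \<le> \<theta>bar\<^sup>2 / (2 * \<mu>bar)" using mubar_pos by simp
  then have lH: "lambda_min H > 0" using H_cond by linarith
  have HH_nonneg: "v \<bullet> (HH *v v) \<ge> 0" for v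
    using HH_ge[of v] lH by (meson mult_nonneg_nonneg less_imp_le order_trans zero_le_power2)
  obtain B where B: "B > 0" "\<And>v. norm (HH *v v) \<le> B * norm v"
    using linear_bounded_pos[OF matrix_vector_mul_linear[of HH]] by metis
  have HH_le: "v \<bullet> (HH *v v) \<le> B * (norm v)\<^sup>2" for v
  proof -
    have "v \<bullet> (HH *v v) \<le> norm v * norm (HH *v v)" by (rule norm_cauchy_schwarz)
    also have "\<dots> \<le> norm v * (B * norm v)" using B by (simp add: mult_left_mono)
    finally show ?thesis by (simp add: power2_eq_square algebra_simps)
  qed

  \<comment> \<open>Equilibrium, error variables and the error recursion\<close>
  have cont: "continuous_on UNIV (pseudo_grad J)"
    using F_lipschitz theta0_pos
    by (intro lipschitz_on_continuous_on[of \<theta>0] lipschitz_onI) (auto simp: dist_norm)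
  obtain z where z: "\<And>i. z $ i \<in> \<Omega> i"
      "\<And>i t. t \<in> \<Omega> i \<Longrightarrow> - (pseudo_grad J z $ i) * (t - z $ i) \<le> 0"
    by (rule box_variational_inequality[where \<Omega> = \<Omega>, OF Omega cont]) blast
  define F where "F = pseudo_grad J z"
  define e where "e k = x k - consensus z" for k
  \<comment> \<open>The single-valued part of the update, centred so that it vanishes at the
    consensus vector of \<open>z\<close>.\<close>
  define A where "A k = R_mat *v (?FF (x k) - F) + c0 *\<^sub>R (LL *v x k)" for k
  define S where "S k = (\<Sum>j<k. x j)" for k
  have LL_e: "LL *v e k = LL *v x k" for k
    by (simp add: e_def LL_eq matrix_vector_mult_diff_distrib stacked_laplacian_consensus)

  have A_mono: "A k \<bullet> e k \<ge> \<mu>bar * (norm (e k))\<^sup>2" for k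
  proof -
    let ?a = "norm (mean (x k) - z)" and ?b = "norm (dev (x k))"
    have mean_e: "mean (e k) = mean (x k) - z" "dev (e k) = dev (x k)"
      by (simp_all add: e_def dev_def mean_def consensus_def vec_eq_iff sum_subtractf field_simps)
    have "e k \<bullet> (R_mat *v (?FF (x k) - F)) \<ge> \<mu> * ?a\<^sup>2 - (\<theta> + \<theta>0) * ?a * ?b - \<theta> * ?b\<^sup>2"
      unfolding e_def F_def ext_pseudo_grad_consensus[symmetric]
      using strongly_monotone F_lipschitz FF_lipschitz theta0_pos theta_pos
      by (intro restricted_monotone) (simp_all add: ext_pseudo_grad_consensus)
    moreover have "e k \<bullet> (LL *v x k) \<ge> ?l * ?b\<^sup>2"
      using lambda2_dev_le[OF E_undirected E_loopfree E_connected E_no_isolated, of "e k"] mean_e LL_e[of k]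
      by (simp add: LL_eq L_eq)
    then have "c0 * (e k \<bullet> (LL *v x k)) \<ge> c0 * ?l * ?b\<^sup>2"
      using c0_pos by (simp add: mult.assoc)
    ultimately have "A k \<bullet> e k \<ge> \<mu> * ?a\<^sup>2 - (\<theta> + \<theta>0) * ?a * ?b + (c0 * ?l - \<theta>) * ?b\<^sup>2"
      by (simp add: A_def inner_add_left inner_commute[of _ "e k"] algebra_simps)
    \<comment> \<open>\<open>\<Psi>\<close> is the matrix of this form in the orthonormal scaling
      \<open>sqrt ?N * ?a\<close>, \<open>?b\<close>, whose squares add up to the squared norm of
      the error.\<close>
    also have "\<mu> * ?a\<^sup>2 - (\<theta> + \<theta>0) * ?a * ?b + (c0 * ?l - \<theta>) * ?b\<^sup>2 =
        \<mu> / ?N * (sqrt ?N * ?a)\<^sup>2 + 2 * q * (sqrt ?N * ?a) * ?b + (c0 * ?l - \<theta>) * ?b\<^sup>2"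
      using N by (simp add: q_def power_mult_distrib field_simps)
    finally have "A k \<bullet> e k \<ge> \<mu>bar * ((sqrt ?N * ?a)\<^sup>2 + ?b\<^sup>2)"
      using lambda_min_2_le[of "\<mu> / ?N" q "c0 * ?l - \<theta>" "sqrt ?N * ?a" ?b]
      unfolding mubar_eq Psi_eq q_def[symmetric] by linarith
    also have "(sqrt ?N * ?a)\<^sup>2 + ?b\<^sup>2 = (norm (e k))\<^sup>2"
      using norm_mean_dev[of "e k"] by (simp add: mean_e power_mult_distrib)
    finally show ?thesis .
  qed
  have LL_le: "norm (LL *v v) \<le> 2 * ?d * norm v" for v
    unfolding LL_eq
    by (rule norm_stacked_laplacian_le[OF E_undirected max_degree_pos[OF E_no_isolated]])
  have A_le: "norm (A k) \<le> \<theta>bar * norm (e k)" for k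
  proof -
    have "norm (A k) \<le> norm (R_mat *v (?FF (x k) - F)) + norm (c0 *\<^sub>R (LL *v e k))"
      unfolding A_def LL_e by (rule norm_triangle_ineq)
    also have "\<dots> \<le> \<theta> * norm (e k) + c0 * (2 * ?d * norm (e k))"
      using FF_lipschitz[of "x k" "consensus z"] LL_le[of "e k"] c0_pos
      by (intro add_mono) (auto simp: norm_R_mat ext_pseudo_grad_consensus F_def e_def)
    finally show ?thesis by (simp add: thetabar_eq algebra_simps)
  qed

  have H_eq': "H = diag_mat \<beta> + (2 * (c + c0)) *\<^sub>R degree_mat E - c *\<^sub>R laplacian E"
    by (simp add: H_eq cbar_eq L_eq)
  note steps = algorithm Omega beta_pos less_imp_le[OF c_pos] less_imp_le[OF c0_pos] H_eq'
  \<comment> \<open>The start \<open>w 0 = 0\<close> keeps the dual iterates in the range of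
    \<open>LL\<close>.\<close>
  have w: "w k = c *\<^sub>R (LL *v S k)" for k
  proof (induction k)
    case 0
    show ?case using algorithm by (simp add: S_def generated_by_algorithm_def Let_def)
  next
    case (Suc k)
    then show ?case
      using dual_step[OF steps, of k] by (simp add: S_def LL_eq matrix_vector_right_distrib scaleR_right_distrib)
  qed
  have "\<forall>k. \<exists>y. y \<in> G_map \<Omega> (x (Suc k)) \<and>
      HH *v (x k - x (Suc k)) = R_mat *v (?FF (x k) + y) + w (Suc (Suc k)) + c0 *\<^sub>R (LL *v x k)"
    using primal_step[OF steps] by (auto simp: HH_def LL_eq)
  then obtain Y where Y: "\<And>k. Y k \<in> G_map \<Omega> (x (Suc k))"
      "\<And>k. HH *v (x k - x (Suc k)) = R_mat *v (?FF (x k) + Y k) + w (Suc (Suc k)) + c0 *\<^sub>R (LL *v x k)"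
    by metis
  have e_diff: "e k - e (Suc k) = x k - x (Suc k)" for k
    by (simp add: e_def)
  define r where "r k = R_mat *v (Y k + F)" for k
  have eq: "HH *v (e k - e (Suc k)) = A k + r k + w (Suc (Suc k))" for k
    unfolding e_diff Y(2) A_def r_def
    by (simp add: matrix_vector_right_distrib matrix_vector_mult_diff_distrib)
  have r_nonneg: "r k \<bullet> e (Suc k) \<ge> 0" for k
  proof -
    \<comment> \<open>By the variational inequality \<open>- F\<close> is normal at
      \<open>z\<close>, so \<open>Y k + F\<close> is a difference of normal vectors and the normal
      cone is monotone. This is also why the dual variable needs no centring.\<close>
    have "(Y k $ i - - F $ i) * (x (Suc k) $ (i, i) - z $ i) \<ge> 0" for i
      using Y(1)[of k] z
      by (intro normal_cone_monotone[of _ "\<Omega> i"])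
        (auto simp: G_map_def subdifferential_ind_fun, simp add: normal_cone_def F_def)
    then have "diagv (e (Suc k)) \<bullet> (Y k + F) \<ge> 0"
      by (auto simp: inner_vec_def diagv_def e_def consensus_def mult.commute intro!: sum_nonneg)
    then show ?thesis
      by (simp add: r_def inner_R_mat inner_commute[of _ "e (Suc k)"])
  qed

  \<comment> \<open>Decrease and upper bound of the Lyapunov function\<close>
  define V where "V k = e k \<bullet> (HH *v e k) + c * (S (Suc k) \<bullet> (LL *v S (Suc k)))" for k
  define a where "a k = (norm (e k))\<^sup>2 + (norm (e k - e (Suc k)))\<^sup>2" for k
  \<comment> \<open>The matrix of the quadratic loss in \<open>lyapunov_step\<close>; its
    determinant is positive by \<open>H_cond\<close>.\<close>
  define \<delta> where "\<delta> = lambda_min (vector [vector [2 * \<mu>bar, - \<theta>bar], vector [- \<theta>bar, lambda_min H]] :: real^2^2)"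
  have \<delta>: "\<delta> > 0"
    unfolding \<delta>_def using mubar_pos H_cond by (intro lambda_min_2_pos) (auto simp: field_simps)
  have dec: "V (Suc k) \<le> V k - \<delta> * a k" for k
  proof -
    \<comment> \<open>The dual energy in \<open>V\<close> runs one index ahead because
      \<open>eq\<close> at \<open>k\<close> contains \<open>w (Suc (Suc k))\<close>; the increment
      of the sums is then \<open>x (Suc k)\<close>.\<close>
    have "LL *v e (Suc k) = LL *v (S (Suc (Suc k)) - S (Suc k))"
      by (simp add: LL_e S_def)
    from lyapunov_step[OF HH_sym LL_sym LL_nonneg HH_ge eq[unfolded w] r_nonneg this A_mono A_le]
    have "V (Suc k) \<le> V k - (2 * \<mu>bar * (norm (e k))\<^sup>2 + 2 * (- \<theta>bar) * norm (e k) * norm (e k - e (Suc k))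
        + lambda_min H * (norm (e k - e (Suc k)))\<^sup>2)"
      using c_pos by (simp add: V_def)
    then show ?thesis
      using lambda_min_2_le[of "2 * \<mu>bar" "- \<theta>bar" "lambda_min H" "norm (e k)" "norm (e k - e (Suc k))"]
      unfolding \<delta>_def a_def by linarith
  qed
  have V_nonneg: "V k \<ge> 0" for k
    using HH_nonneg LL_nonneg c_pos by (simp add: V_def)
  have e_Suc: "(norm (e (Suc k)))\<^sup>2 \<le> 2 * a k" for k
  proof -
    have "norm (e (Suc k)) \<le> norm (e k) + norm (e k - e (Suc k))"
      using norm_triangle_ineq4[of "e k" "e k - e (Suc k)"] by simp
    then have "(norm (e (Suc k)))\<^sup>2 \<le> (norm (e k) + norm (e k - e (Suc k)))\<^sup>2"
      by (simp add: power_mono)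
    also have "\<dots> \<le> 2 * a k"
      unfolding a_def by (rule square_add_le)
    finally show ?thesis .
  qed
  define K1 where "K1 = real CARD('n \<times> 'n) * ?N"
  \<comment> \<open>The first summand bounds the primal energy through \<open>e_Suc\<close>. The
    second bounds the dual energy by the squared norm of the dual iterate over
    \<open>c * ?l\<close>; that norm is at most \<open>K1\<close> times the norm of the
    single-valued part of \<open>eq\<close>.\<close>
  define K where "K = 2 * B + 2 * K1\<^sup>2 * (B\<^sup>2 + \<theta>bar\<^sup>2) / (c * ?l)"
  have K: "K > 0"
    using B c_pos l by (simp add: K_def add_pos_nonneg)
  have V_le: "V (Suc k) \<le> K * a k" for k
  proof -
    let ?W = "w (Suc (Suc k))" and ?g = "HH *v (e k - e (Suc k)) - A k" and ?S = "S (Suc (Suc k))"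
    have "norm ?W \<le> K1 * norm ?g"
      unfolding K1_def
    proof (rule norm_dual_le)
      show "?W = ?g - R_mat *v (Y k + F)"
        using eq[of k] by (simp add: r_def)
      show "(\<Sum>i\<in>UNIV. ?W $ (i, m)) = 0" for m
        by (simp add: w LL_eq sum_col_stacked_laplacian[OF E_undirected] flip: sum_distrib_left)
    qed
    moreover have "norm ?g \<le> B * norm (e k - e (Suc k)) + \<theta>bar * norm (e k)"
      using norm_triangle_ineq4[of "HH *v (e k - e (Suc k))" "A k"] B(2)[of "e k - e (Suc k)"] A_le[of k] by linarith
    then have "(norm ?g)\<^sup>2 \<le> (B * norm (e k - e (Suc k)) + \<theta>bar * norm (e k))\<^sup>2"
      by (simp add: power_mono)
    moreover have "\<dots> \<le> 2 * ((B * norm (e k - e (Suc k)))\<^sup>2 + (\<theta>bar * norm (e k))\<^sup>2)"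
      by (rule square_add_le)
    moreover have "\<dots> \<le> 2 * ((B\<^sup>2 + \<theta>bar\<^sup>2) * a k)"
      by (simp add: a_def power_mult_distrib algebra_simps)
    ultimately have "(norm ?W)\<^sup>2 \<le> K1\<^sup>2 * (2 * ((B\<^sup>2 + \<theta>bar\<^sup>2) * a k))"
      using power_mono[of "norm ?W" "K1 * norm ?g" 2]
        mult_left_mono[of "(norm ?g)\<^sup>2" "2 * ((B\<^sup>2 + \<theta>bar\<^sup>2) * a k)" "K1\<^sup>2"]
      by (simp add: power_mult_distrib)
    moreover have "(norm ?W)\<^sup>2 = c * (c * (norm (LL *v ?S))\<^sup>2)"
      by (simp add: w power_mult_distrib power2_eq_square)
    moreover have "c * (c * (norm (LL *v ?S))\<^sup>2) \<ge> c * (c * (?l * (?S \<bullet> (LL *v ?S))))"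
      unfolding LL_eq L_eq using c_pos
      by (intro mult_left_mono inner_stacked_laplacian_le_norm[OF E_undirected E_loopfree E_connected E_no_isolated]) auto
    ultimately have "(c * ?l) * (c * (?S \<bullet> (LL *v ?S))) \<le> 2 * K1\<^sup>2 * (B\<^sup>2 + \<theta>bar\<^sup>2) * a k"
      by (simp add: algebra_simps)
    then have "c * (?S \<bullet> (LL *v ?S)) \<le> 2 * K1\<^sup>2 * (B\<^sup>2 + \<theta>bar\<^sup>2) * a k / (c * ?l)"
      using c_pos l by (subst pos_le_divide_eq) (simp_all add: mult.commute)
    moreover have "e (Suc k) \<bullet> (HH *v e (Suc k)) \<le> B * (2 * a k)"
      using HH_le[of "e (Suc k)"] mult_left_mono[OF e_Suc[of k], of B] B by linarith
    ultimately show ?thesis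
      by (simp add: V_def K_def algebra_simps)
  qed
  obtain \<rho> C where \<rho>: "0 \<le> \<rho>" "\<rho> < 1" and geo: "\<And>k. a k \<le> C * \<rho> ^ k"
    by (rule lyapunov_geometric[where V = V and a = a, OF \<delta> K V_nonneg dec V_le]) blast

  \<comment> \<open>The two convergence rates\<close>
  have "(\<lambda>k. (weighted_norm LL (xperp k))\<^sup>2) \<in> o(\<lambda>k. 1 / real k)"
  proof (rule geometric_smallo[OF \<rho>])
    fix k
    have "(weighted_norm LL (xperp (Suc k)))\<^sup>2 = e (Suc k) \<bullet> (LL *v e (Suc k))"
      using weighted_norm_perp_part[OF LL_sym LL_nonneg]
        symmetric_inner[OF LL_sym, of "x (Suc k)" "x (Suc k)"]
        symmetric_inner[OF LL_sym, of "e (Suc k)" "x (Suc k)"]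
      by (simp add: xperp_eq LL_e)
    also have "\<dots> \<le> 2 * ?d * (norm (e (Suc k)))\<^sup>2"
      unfolding LL_eq by (rule inner_stacked_laplacian_le[OF E_undirected])
    also have "\<dots> \<le> 2 * ?d * (2 * (C * \<rho> ^ k))"
      using e_Suc[of k] geo[of k] by (intro mult_left_mono) auto
    finally show "(weighted_norm LL (xperp (Suc k)))\<^sup>2 \<le> 4 * ?d * C * \<rho> ^ k"
      by (simp add: mult.assoc)
  qed simp
  \<comment> \<open>\<open>Y k\<close> is normal at \<open>x (Suc k)\<close>, so the witness at
    \<open>k\<close> is \<open>Y (k - 1)\<close>. For \<open>Suc k\<close> the residual equals
    \<open>HH *v (x k - x (Suc k))\<close>; truncated subtraction affects only index 0, outside the
    range of the bound.\<close>
  moreover have "(\<lambda>k. (weighted_norm (matrix_inv HH)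
      (R_mat *v (?FF (x (k - 1)) + Y (k - 1)) + w (k + 1) + c0 *\<^sub>R (LL *v xperp (k - 1))))\<^sup>2) \<in> o(\<lambda>k. 1 / real k)"
  proof (rule geometric_smallo[OF \<rho>])
    fix k
    have "(weighted_norm (matrix_inv HH) (R_mat *v (?FF (x (Suc k - 1)) + Y (Suc k - 1)) + w (Suc k + 1)
        + c0 *\<^sub>R (LL *v xperp (Suc k - 1))))\<^sup>2 = (e k - e (Suc k)) \<bullet> (HH *v (e k - e (Suc k)))"
      using weighted_norm_matrix_inv[OF lH HH_ge, of "x k - x (Suc k)"] Y(2)[of k]
      by (simp add: xperp_eq perp_part_kernel e_diff)
    also have "\<dots> \<le> B * (norm (e k - e (Suc k)))\<^sup>2"
      by (rule HH_le)
    also have "\<dots> \<le> B * (C * \<rho> ^ k)"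
      using geo[of k] B by (intro mult_left_mono) (auto simp: a_def intro: order_trans[rotated])
    finally show "(weighted_norm (matrix_inv HH) (R_mat *v (?FF (x (Suc k - 1)) + Y (Suc k - 1)) + w (Suc k + 1)
        + c0 *\<^sub>R (LL *v xperp (Suc k - 1))))\<^sup>2 \<le> B * C * \<rho> ^ k"
      by (simp add: mult.assoc)
  qed simp
  moreover have "\<forall>k\<ge>1. Y (k - 1) \<in> G_map \<Omega> (x k)"
    using Y(1) by (metis Suc_diff_1 less_le_trans zero_less_one)
  ultimately show ?thesis
    unfolding HH_def by (intro conjI exI[of _ "\<lambda>k. Y (k - 1)"])
qed

end
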